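(* (a) (Type I model.) Let $\mu$ be a probability measure on $\mathcal{X}_0$ with $\mu^{\mathbb{Z}}(\mathcal{X}^* )=1$. Then $\mathcal{T}\mu^{\mathbb{Z}}=\mu^{\mathbb{Z}}$ if and only if there exists a probability measure $\nu$ on $\mathcal{U}_0$ such that $F(\mu\times\nu)=\mu\times\nu$. Moreover, when this holds, $\nu$ is the distribution of $U_n(x)$ for each $n\in\mathbb{Z}$, where $x$ is distributed according to $\mu^{\mathbb{Z}}$. (b) (Type II model.) Let $\mu,\tilde\mu$ be probability measures on $\mathcal{X}_0,\tilde{\mathcal{X}}_0$ respectively with $(\mu\times\tilde\mu)^{\mathbb{Z}}(\mathcal{X}^* )=1$. Then $\mathcal{T}(\mu\times\tilde\mu)^{\mathbb{Z}}=(\mu\times\tilde\mu)^{\mathbb{Z}}$ if and only if there exist probability measures $\nu,\tilde\nu$ on $\mathcal{U}_0,\tilde{\mathcal{U}}_0$ respectively such that $F_*(\mu\times\nu)=\tilde\mu\times\tilde\nu$. Moreover, when this holds, $\nu$ and $\tilde\nu$ are the distributions of $U_{2n-1}(x)$ and $U_{2n}(x)$ respectively, for each $n\in\mathbb{Z}$, where $x$ is distributed according to $(\mu\times\tilde\mu)^{\mathbb{Z}}$.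
   Context: Type I model: $\mathcal{X}_0,\mathcal{U}_0$ are Polish spaces and $F:\mathcal{X}_0\times\mathcal{U}_0\to\mathcal{X}_0\times\mathcal{U}_0$ is an involution; set $F_n^t:=F$ for all $n,t\in\mathbb{Z}$, and configurations are elements $x=(x_n)_{n\in\mathbb{Z}}\in\mathcal{X}_0^{\mathbb{Z}}$. Type II model: $\mathcal{X}_0,\tilde{\mathcal{X}}_0,\mathcal{U}_0,\tilde{\mathcal{U}}_0$ are Polish spaces and $F_*:\mathcal{X}_0\times\mathcal{U}_0\to\tilde{\mathcal{X}}_0\times\tilde{\mathcal{U}}_0$ is a bijection; set $F_n^t:=F_*$ if $n+t$ is even and $F_n^t:=F_*^{-1}$ if $n+t$ is odd; lattice variables satisfy $x_n^t\in\mathcal{X}_0$, $u_n^t\in\tilde{\mathcal{U}}_0$ if $n+t$ is even and $x_n^t\in\tilde{\mathcal{X}}_0$, $u_n^t\in\mathcal{U}_0$ if $n+t$ is odd; configurations are $x=(x_n)_{n\in\mathbb{Z}}$ with $x_n\in\mathcal{X}_0$ for $n$ even and $x_n\in\tilde{\mathcal{X}}_0$ for $n$ odd, and $(\mu\times\tilde\mu)^{\mathbb{Z}}$ denotes the product law under which $x_n\sim\mu$ for even $n$ and $x_n\sim\tilde\mu$ for odd $n$, all independent. In either case, $\mathcal{X}^*$ is the set of configurations $x$ for which there is a unique family $(x_n^t,u_n^t)_{n,t\in\mathbb{Z}}$ with $F_n^t(x_n^t,u_{n-1}^t)=(x_n^{t+1},u_n^t)$ for all $n,t\in\mathbb{Z}$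 and $x_n^0=x_n$ for all $n$. For $x\in\mathcal{X}^*$, $U_n(x):=u_n^0$, and the one-step dynamics is $\mathcal{T}(x)_n:=x_n^1$ for a type I model and $\mathcal{T}(x)_n:=x_{n+1}^1$ for a type II model. For a measurable map $G$ and a measure $m$, $G(m):=m\circ G^{-1}$ denotes the pushforward. *)

theory Defs
  imports "HOL-Probability.Probability"
begin

definition sol1 :: "('x \<times> 'u \<Rightarrow> 'x \<times> 'u) \<Rightarrow> (int \<Rightarrow> 'x)
    \<Rightarrow> (int \<Rightarrow> int \<Rightarrow> 'x) \<Rightarrow> (int \<Rightarrow> int \<Rightarrow> 'u) \<Rightarrow> bool" where
  "sol1 F x xs us \<longleftrightarrow>
     (\<forall>n t. F (xs n t, us (n - 1) t) = (xs n (t + 1), us n t)) \<and> (\<forall>n. xs n 0 = x n)"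

definition Xstar1 :: "('x \<times> 'u \<Rightarrow> 'x \<times> 'u) \<Rightarrow> (int \<Rightarrow> 'x) set" where
  "Xstar1 F = {x. \<exists>!p. sol1 F x (fst p) (snd p)}"

definition solof1 :: "('x \<times> 'u \<Rightarrow> 'x \<times> 'u) \<Rightarrow> (int \<Rightarrow> 'x)
    \<Rightarrow> (int \<Rightarrow> int \<Rightarrow> 'x) \<times> (int \<Rightarrow> int \<Rightarrow> 'u)" where
  "solof1 F x = (THE p. sol1 F x (fst p) (snd p))"

text \<open>One-step dynamics T(x)_n = x_n^1 (identity off X*, a null set).\<close>
definition T1 :: "('x \<times> 'u \<Rightarrow> 'x \<times> 'u) \<Rightarrow> (int \<Rightarrow> 'x) \<Rightarrow> (int \<Rightarrow> 'x)" where
  "T1 F x = (if x \<in> Xstar1 F then (\<lambda>n. fst (solof1 F x) n 1) else x)"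

definition U1 :: "('x \<times> 'u \<Rightarrow> 'x \<times> 'u) \<Rightarrow> int \<Rightarrow> (int \<Rightarrow> 'x) \<Rightarrow> 'u" where
  "U1 F n x = (if x \<in> Xstar1 F then snd (solof1 F x) n 0 else undefined)"

text \<open>A configuration is encoded as c :: int => X0 x X~0 with c k = (x_{2k}, x_{2k+1});
  under this encoding the law (mu x mu~)^Z is the product of mu x mu~ over Z.
  cfg2 c n is the n-th site value x_n, tagged Inl (in X0) for even n and Inr (in X~0) for odd n.\<close>
definition cfg2 :: "(int \<Rightarrow> 'x \<times> 'xt) \<Rightarrow> int \<Rightarrow> 'x + 'xt" where
  "cfg2 c n = (if even n then Inl (fst (c (n div 2))) else Inr (snd (c (n div 2))))"

text \<open>Lattice variables: xs n t :: X0 + X~0, us n t :: U0 + U~0, where Inl/Inr encode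
  the parity-dependent spaces: x_n^t in X0 iff n+t even, u_n^t in U~0 iff n+t even.
  F_n^t = F* if n+t even, inverse of F* if n+t odd.\<close>
definition sol2 :: "('x \<times> 'u \<Rightarrow> 'xt \<times> 'ut) \<Rightarrow> (int \<Rightarrow> 'x \<times> 'xt)
    \<Rightarrow> (int \<Rightarrow> int \<Rightarrow> 'x + 'xt) \<Rightarrow> (int \<Rightarrow> int \<Rightarrow> 'u + 'ut) \<Rightarrow> bool" where
  "sol2 F c xs us \<longleftrightarrow>
     (\<forall>n t. if even (n + t) then
        (\<exists>a b. xs n t = Inl a \<and> us (n - 1) t = Inl b \<and>
               xs n (t + 1) = Inr (fst (F (a, b))) \<and> us n t = Inr (snd (F (a, b))))
      else
        (\<exists>a b. xs n t = Inr a \<and> us (n - 1) t = Inr b \<and>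
               xs n (t + 1) = Inl (fst (inv F (a, b))) \<and> us n t = Inl (snd (inv F (a, b)))))
     \<and> (\<forall>n. xs n 0 = cfg2 c n)"

definition Xstar2 :: "('x \<times> 'u \<Rightarrow> 'xt \<times> 'ut) \<Rightarrow> (int \<Rightarrow> 'x \<times> 'xt) set" where
  "Xstar2 F = {c. \<exists>!p. sol2 F c (fst p) (snd p)}"

definition solof2 :: "('x \<times> 'u \<Rightarrow> 'xt \<times> 'ut) \<Rightarrow> (int \<Rightarrow> 'x \<times> 'xt)
    \<Rightarrow> (int \<Rightarrow> int \<Rightarrow> 'x + 'xt) \<times> (int \<Rightarrow> int \<Rightarrow> 'u + 'ut)" where
  "solof2 F c = (THE p. sol2 F c (fst p) (snd p))"

text \<open>T(x)_n = x_{n+1}^1; in the pair encoding T(c) k = (x_{2k+1}^1, x_{2k+2}^1)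
  (identity off X*).\<close>
definition T2 :: "('x \<times> 'u \<Rightarrow> 'xt \<times> 'ut) \<Rightarrow> (int \<Rightarrow> 'x \<times> 'xt) \<Rightarrow> (int \<Rightarrow> 'x \<times> 'xt)" where
  "T2 F c = (if c \<in> Xstar2 F then
      (\<lambda>k. (projl (fst (solof2 F c) (2 * k + 1) 1), projr (fst (solof2 F c) (2 * k + 2) 1)))
     else c)"

definition U2 :: "('x \<times> 'u \<Rightarrow> 'xt \<times> 'ut) \<Rightarrow> int \<Rightarrow> (int \<Rightarrow> 'x \<times> 'xt) \<Rightarrow> 'u + 'ut" where
  "U2 F n c = (if c \<in> Xstar2 F then snd (solof2 F c) n 0 else undefined)"

definition Uodd2 :: "('x \<times> 'u \<Rightarrow> 'xt \<times> 'ut) \<Rightarrow> int \<Rightarrow> (int \<Rightarrow> 'x \<times> 'xt) \<Rightarrow> 'u" where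
  "Uodd2 F n c = projl (U2 F (2 * n - 1) c)"

definition Ueven2 :: "('x \<times> 'u \<Rightarrow> 'xt \<times> 'ut) \<Rightarrow> int \<Rightarrow> (int \<Rightarrow> 'x \<times> 'xt) \<Rightarrow> 'ut" where
  "Ueven2 F n c = projr (U2 F (2 * n) c)"

end

theory Submission
  imports Defs
begin

text \<open>If a local map preserves a product law, independent cell inputs along one antidiagonal of the
  lattice propagate to a stationary random field whose rows are independent; uniqueness of the
  solution identifies this field with the dynamics. Conversely, cutting two solutions along a
  vertical line and refilling the quadrant in between shows that the carrier \<open>U\<^sub>n(x)\<close> depends only
  on the sites up to \<open>n\<close>, and by reflection it depends only on the sites of \<open>T(x)\<close> beyond \<open>n\<close>.
  So both the inputs and the outputs of a cell are independent once \<open>T\<close> preserves the row law.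
  Type I models are type II models whose inverse map is the map itself.\<close>


section \<open>Borel inverses off a null set\<close>

text \<open>Along a row the carriers are functions of the sites, so the cells of a row cannot be
  given independent inputs. On an antidiagonal \<open>n + t = s\<close> no cell feeds another, and
  all inputs can be prescribed freely. The price is that a row meets each antidiagonal only once:
  its sites are read at different stages of the propagation, and their joint law has to be assembled
  site by site. The second obstacle is the backward direction. The inverse of a Borel bijection is
  needed as a measurable map; a map \<open>G\<close> that inverts \<open>F\<close> almost surely is
  enough, because the lattice has only countably many cells. Independence is obtained by splicing
  two independent copies of a row, which reproduces the row law. This suits statements about
  carriers, which are available only on a set of rows of full measure.\<close>

text \<open>Inner regularity of the law of the graph of \<open>F\<close> gives compact subsets of the graph, whose
  projections are compact; this replaces the Lusin--Souslin theorem, at the cost of a null set.\<close>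

lemma borel_subset_of_image:
  fixes F :: "'a::{second_countable_topology, complete_space}
    \<Rightarrow> 'b::{second_countable_topology, complete_space}"
  assumes F [measurable]: "F \<in> borel \<rightarrow>\<^sub>M borel"
    and m: "prob_space m" "sets m = sets borel" and S [measurable]: "S \<in> sets borel"
  obtains D where "D \<in> sets borel" "D \<subseteq> F ` S" "emeasure m S \<le> emeasure (distr m borel F) D"
proof -
  note [measurable_cong] = m(2)
  define L where "L = distr m borel (\<lambda>z. (z, F z))"
  have graph_meas [measurable]: "(\<lambda>z. (z, F z)) \<in> m \<rightarrow>\<^sub>M borel"
    by (intro borel_measurable_Pair) measurable
  define \<Gamma> where "\<Gamma> = {p. fst p \<in> S \<and> F (fst p) = snd p}"
  \<comment> \<open>The diagonal is closed, so the graph of \<open>F\<close>, a preimage of it under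
    a Borel map, is Borel.\<close>
  have "closed {p :: 'b \<times> 'b. fst p = snd p}"
    by (intro closed_Collect_eq continuous_intros)
  then have diag: "{p :: 'b \<times> 'b. fst p = snd p} \<in> sets borel" by simp
  have fst_borel [measurable]: "fst \<in> borel_measurable (borel :: ('a \<times> 'b) measure)"
    and snd_borel [measurable]: "snd \<in> borel_measurable (borel :: ('a \<times> 'b) measure)"
    by (auto intro!: borel_measurable_continuous_onI continuous_intros)
  have "(\<lambda>p :: 'a \<times> 'b. (F (fst p), snd p)) \<in> borel \<rightarrow>\<^sub>M borel"
    by (intro borel_measurable_Pair) measurable
  from measurable_sets[OF this diag] have "{p. F (fst p) = snd p} \<in> sets borel"
    by (simp add: vimage_def)
  moreover have "fst -` S \<inter> space borel \<in> sets (borel :: ('a \<times> 'b) measure)"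
    by measurable
  ultimately have "{p. F (fst p) = snd p} \<inter> (fst -` S \<inter> space borel)
      \<in> sets (borel :: ('a \<times> 'b) measure)"
    by (rule sets.Int)
  also have "{p. F (fst p) = snd p} \<inter> (fst -` S \<inter> space borel) = \<Gamma>"
    by (auto simp: \<Gamma>_def)
  finally have \<Gamma> [measurable]: "\<Gamma> \<in> sets borel" .
  interpret m: prob_space m by fact
  interpret L: prob_space L unfolding L_def by (rule m.prob_space_distr) measurable
  let ?\<K> = "{K. K \<subseteq> \<Gamma> \<and> compact K}"
  have SUP: "emeasure L \<Gamma> = (SUP K\<in>?\<K>. emeasure L K)"
    by (rule inner_regular) (use L.emeasure_space_1 in \<open>simp_all add: L_def\<close>)
  have "?\<K> \<noteq> {}" by (auto intro!: exI[of _ "{}"])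
  \<comment> \<open>A sequence of compact sets already attains the supremum, so countably many
    projections suffice and their union is Borel.\<close>
  with SUP obtain f :: "nat \<Rightarrow> ennreal"
    where f: "range f \<subseteq> emeasure L ` ?\<K>" "emeasure L \<Gamma> = (SUP i. f i)"
    
    using ennreal_Sup_countable_SUP[of "emeasure L ` ?\<K>"] by auto
  then have "\<forall>i. \<exists>K. K \<subseteq> \<Gamma> \<and> compact K \<and> f i = emeasure L K" by blast
  then obtain K where K: "\<And>i. K i \<subseteq> \<Gamma>" "\<And>i. compact (K i)" "\<And>i. f i = emeasure L (K i)"
    by metis
  have compact_proj: "compact (snd ` K i)" for i
    using K(2) by (intro compact_continuous_image continuous_intros)
  then have proj_borel [measurable]: "snd ` K i \<in> sets borel" for i
    by (simp add: compact_imp_closed)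
  have K_borel [measurable]: "K i \<in> sets borel" for i
    using K(2) by (simp add: compact_imp_closed)
  have space_m: "space m = UNIV"
    using sets_eq_imp_space_eq[OF m(2)] by simp
  show thesis
  proof (rule that[of "\<Union>i. snd ` K i"])
    show "(\<Union>i. snd ` K i) \<in> sets borel" by measurable
    show "(\<Union>i. snd ` K i) \<subseteq> F ` S" using K(1) unfolding \<Gamma>_def by force
    have "emeasure m S = emeasure L \<Gamma>"
      unfolding L_def by (subst emeasure_distr) (auto simp: \<Gamma>_def space_m intro!: arg_cong[where f="emeasure m"])
    also have "\<dots> \<le> emeasure (distr m borel F) (\<Union>i. snd ` K i)"
      unfolding f(2)
    proof (rule SUP_least)
      fix i
      have "f i = emeasure m ((\<lambda>z. (z, F z)) -` K i \<inter> space m)"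
        unfolding K(3) L_def by (subst emeasure_distr) auto
      also have "\<dots> \<le> emeasure m (F -` (\<Union>i. snd ` K i) \<inter> space m)"
        by (intro emeasure_mono) (force, measurable)
      also have "\<dots> = emeasure (distr m borel F) (\<Union>i. snd ` K i)"
        by (subst emeasure_distr) auto
      finally show "f i \<le> emeasure (distr m borel F) (\<Union>i. snd ` K i)" .
    qed
    finally show "emeasure m S \<le> emeasure (distr m borel F) (\<Union>i. snd ` K i)" .
  qed
qed

text \<open>For a basic open set \<open>b\<close>, Borel subsets of the images of \<open>b\<close>
  and of its complement are disjoint by injectivity and together carry all the mass. On the
  intersection over a countable basis, membership in \<open>D b\<close> decides whether the preimage
  lies in \<open>b\<close>, so the set-theoretic inverse is Borel there.\<close>

lemma borel_inverse_AE:
  fixes F :: "'a::{second_countable_topology, complete_space}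
    \<Rightarrow> 'b::{second_countable_topology, complete_space}"
  assumes F [measurable]: "F \<in> borel \<rightarrow>\<^sub>M borel" and inj: "inj F"
    and m: "prob_space m" "sets m = sets borel"
  obtains G where "G \<in> borel \<rightarrow>\<^sub>M borel" "AE w in distr m borel F. F (G w) = w"
proof -
  note [measurable_cong] = m(2)
  interpret m: prob_space m by fact
  let ?Q = "distr m borel F"
  interpret Q: prob_space ?Q by (rule m.prob_space_distr) measurable
  obtain B :: "'a set set" where B: "countable B" "topological_basis B"
    using ex_countable_basis by blast
  have openB: "b \<in> B \<Longrightarrow> open b" for b
    using B(2) by (rule topological_basis_open)
  have "\<forall>b\<in>B. \<exists>D. D \<in> sets borel \<and> D \<subseteq> F ` b \<and> emeasure m b \<le> emeasure ?Q D"
  proof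
    fix b assume "b \<in> B"
    then have "b \<in> sets borel" using openB by simp
    then obtain D where "D \<in> sets borel" "D \<subseteq> F ` b" "emeasure m b \<le> emeasure ?Q D"
      by (rule borel_subset_of_image[OF F m])
    then show "\<exists>D. D \<in> sets borel \<and> D \<subseteq> F ` b \<and> emeasure m b \<le> emeasure ?Q D"
      by (intro exI conjI)
  qed
  then obtain D where D: "\<And>b. b \<in> B \<Longrightarrow> D b \<in> sets borel" "\<And>b. b \<in> B \<Longrightarrow> D b \<subseteq> F ` b"
    "\<And>b. b \<in> B \<Longrightarrow> emeasure m b \<le> emeasure ?Q (D b)" by metis
  have "\<forall>b\<in>B. \<exists>D. D \<in> sets borel \<and> D \<subseteq> F ` (- b) \<and> emeasure m (- b) \<le> emeasure ?Q D"
  proof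
    fix b assume "b \<in> B"
    then have "- b \<in> sets borel" using openB by simp
    then obtain D where "D \<in> sets borel" "D \<subseteq> F ` (- b)" "emeasure m (- b) \<le> emeasure ?Q D"
      by (rule borel_subset_of_image[OF F m])
    then show "\<exists>D. D \<in> sets borel \<and> D \<subseteq> F ` (- b) \<and> emeasure m (- b) \<le> emeasure ?Q D"
      by (intro exI conjI)
  qed
  then obtain E where E: "\<And>b. b \<in> B \<Longrightarrow> E b \<in> sets borel" "\<And>b. b \<in> B \<Longrightarrow> E b \<subseteq> F ` (- b)"
    "\<And>b. b \<in> B \<Longrightarrow> emeasure m (- b) \<le> emeasure ?Q (E b)" by metis
  have AE_b: "AE w in ?Q. w \<in> D b \<union> E b" if b: "b \<in> B" for b
  proof -
    have "D b \<inter> E b = {}" using D(2)[OF b] E(2)[OF b] inj by (fastforce dest: injD)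
    then have "emeasure ?Q (D b \<union> E b) = emeasure ?Q (D b) + emeasure ?Q (E b)"
      using D(1)[OF b] E(1)[OF b] by (intro plus_emeasure[symmetric]) auto
    moreover have "1 = emeasure m b + emeasure m (- b)"
    proof -
      have "b \<in> sets m" "- b \<in> sets m" using openB[OF b] by (simp_all add: m(2))
      then have "emeasure m b + emeasure m (- b) = emeasure m (b \<union> - b)"
        by (intro plus_emeasure) auto
      also have "b \<union> - b = space m"
        using sets_eq_imp_space_eq[OF m(2)] by auto
      finally show ?thesis by (simp add: m.emeasure_space_1)
    qed
    ultimately have "emeasure ?Q (D b \<union> E b) \<ge> 1"
      using add_mono[OF D(3)[OF b] E(3)[OF b]] by simp
    then show ?thesis
      using D(1)[OF b] E(1)[OF b] Q.measure_le_1
      by (intro Q.AE_in_set_eq_1[THEN iffD2])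
         (auto simp: Q.emeasure_eq_measure intro: antisym)
  qed
  define C where "C = (\<Inter>b\<in>B. D b \<union> E b)"
  have "\<Union>B = UNIV" 
  proof -
    obtain B' where "B' \<subseteq> B" "\<Union>B' = UNIV"
      using B(2) open_UNIV unfolding topological_basis_def by blast
    then show ?thesis by blast
  qed
  then have "B \<noteq> {}" by auto
  have C [measurable]: "C \<in> sets borel"
    unfolding C_def using B(1) \<open>B \<noteq> {}\<close> D(1) E(1) by (intro sets.countable_INT'') auto
  have AE_C: "AE w in ?Q. w \<in> C"
    unfolding C_def using AE_b B(1) by (simp add: AE_ball_countable)
  have C_image: "F (inv F w) = w" if "w \<in> C" for w
  proof -
    obtain b where b: "b \<in> B" using \<open>B \<noteq> {}\<close> by blast
    with that have "w \<in> D b \<union> E b" by (simp add: C_def)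
    with D(2)[OF b] E(2)[OF b] have "w \<in> range F" by auto
    then show ?thesis by (rule f_inv_into_f)
  qed
  \<comment> \<open>A constant value outside the Borel set \<open>C\<close> keeps the map
    Borel.\<close>
  define G where "G w = (if w \<in> C then inv F w else undefined)" for w
  show thesis
  proof (rule that)
    show "G \<in> borel \<rightarrow>\<^sub>M borel"
      unfolding borel_eq_countable_basis[OF B]
    proof (rule measurable_measure_of)
      fix b assume b: "b \<in> B"
      have "inv F w \<in> b \<longleftrightarrow> w \<in> D b" if "w \<in> C" for w
      proof -
        have "w \<in> D b \<or> w \<in> E b" using that b unfolding C_def by blast
        moreover have "w \<in> D b \<Longrightarrow> inv F w \<in> b"
          using D(2)[OF b] inj by (auto simp: inv_f_f)
        moreover have "w \<in> E b \<Longrightarrow> inv F w \<notin> b"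
          using E(2)[OF b] inj by (auto simp: inv_f_f)
        ultimately show ?thesis by blast
      qed
      then have "G -` b \<inter> space borel = (C \<inter> D b) \<union> (if undefined \<in> b then - C else {})"
        by (auto simp: G_def split: if_splits)
      also have "\<dots> \<in> sets borel" using C D(1)[OF b] by auto
      finally show "G -` b \<inter> space borel \<in> sets borel" .
    qed auto
    show "AE w in ?Q. F (G w) = w"
      using AE_C by eventually_elim (simp add: G_def C_image)
  qed
qed

section \<open>Product laws over the integers\<close>

locale product_law =
  fixes \<mu> :: "'a measure" and \<nu> :: "'b measure"
  assumes prob_mu: "prob_space \<mu>" and prob_nu: "prob_space \<nu>"
    and space_mu: "space \<mu> = UNIV" and space_nu: "space \<nu> = UNIV"
begin

sublocale mu: prob_space \<mu> by (rule prob_mu)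
sublocale nu: prob_space \<nu> by (rule prob_nu)
sublocale munu: pair_prob_space \<mu> \<nu> by unfold_locales

abbreviation law :: "(int \<Rightarrow> 'a \<times> 'b) measure" where
  "law \<equiv> \<Pi>\<^sub>M n\<in>UNIV. \<mu> \<Otimes>\<^sub>M \<nu>"

sublocale law: product_prob_space "\<lambda>_. \<mu> \<Otimes>\<^sub>M \<nu>" "UNIV :: int set"
  by unfold_locales

lemma space_law [simp]: "space law = UNIV"
  by (auto simp: space_PiM space_pair_measure space_mu space_nu)

lemma measurable_coord [measurable]:
  "(\<lambda>c. c n) \<in> law \<rightarrow>\<^sub>M \<mu> \<Otimes>\<^sub>M \<nu>"
  by (rule measurable_component_singleton) simp

lemma emeasure_law_box:
  assumes "finite J" "\<And>j. j \<in> J \<Longrightarrow> A j \<in> sets \<mu>" "\<And>j. j \<in> J \<Longrightarrow> B j \<in> sets \<nu>"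
  shows "emeasure law {c. \<forall>j\<in>J. fst (c j) \<in> A j \<and> snd (c j) \<in> B j}
    = (\<Prod>j\<in>J. emeasure \<mu> (A j)) * (\<Prod>j\<in>J. emeasure \<nu> (B j))"
proof -
  have "emeasure law {c\<in>space law. \<forall>j\<in>J. c j \<in> A j \<times> B j}
      = (\<Prod>j\<in>J. emeasure (\<mu> \<Otimes>\<^sub>M \<nu>) (A j \<times> B j))"
    by (rule law.emeasure_PiM_Collect) (use assms in auto)
  also have "\<dots> = (\<Prod>j\<in>J. emeasure \<mu> (A j) * emeasure \<nu> (B j))"
    by (intro prod.cong refl nu.emeasure_pair_measure_Times) (use assms in auto)
  finally show ?thesis
    by (simp add: prod.distrib mem_Times_iff)
qed

lemma sets_law_box:
  assumes "finite J" "\<And>j. j \<in> J \<Longrightarrow> A j \<in> sets \<mu>" "\<And>j. j \<in> J \<Longrightarrow> B j \<in> sets \<nu>"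
  shows "{c. \<forall>j\<in>J. fst (c j) \<in> A j \<and> snd (c j) \<in> B j} \<in> sets law"
proof -
  have "{c \<in> space law. \<forall>j\<in>J. fst (c j) \<in> A j \<and> snd (c j) \<in> B j} \<in> sets law"
    by (rule sets.sets_Collect_finite_All[OF _ assms(1)]) (use assms(2,3) in measurable)
  then show ?thesis by simp
qed

text \<open>Boxes form a generator closed under intersection, and the empty index set fixes the
  total mass. The two components of a site get separate families of sets because they are shifted
  and cut separately below.\<close>

lemma eq_lawI:
  assumes L: "sets L = sets law"
    and box: "\<And>J A B. finite J \<Longrightarrow> (\<And>j. A j \<in> sets \<mu>) \<Longrightarrow> (\<And>j. B j \<in> sets \<nu>) \<Longrightarrow>
      emeasure L {c. \<forall>j\<in>J. fst (c j) \<in> A j \<and> snd (c j) \<in> B j}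
        = (\<Prod>j\<in>J. emeasure \<mu> (A j)) * (\<Prod>j\<in>J. emeasure \<nu> (B j))"
  shows "L = law"
proof -
  define E where "E = {a \<times> b | a b. a \<in> sets \<mu> \<and> b \<in> sets \<nu>}"
  define P where "P = {{f\<in>(\<Pi>\<^sub>E i\<in>(UNIV::int set). UNIV). \<forall>i\<in>j. f i \<in> A i} | A j.
    j \<in> {J. finite J} \<and> A \<in> Pi j (\<lambda>_. E)}"
  have E: "E \<subseteq> Pow UNIV" by simp
  have "sets law = sets (\<Pi>\<^sub>M i\<in>(UNIV::int set). sigma UNIV E)"
    by (intro sets_PiM_cong refl)
       (simp add: sets_pair_measure space_mu space_nu E_def)
  also have "\<dots> = sets (sigma (\<Pi>\<^sub>E i\<in>(UNIV::int set). UNIV) P)"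
    unfolding P_def
  proof (rule sets_PiM_sigma)
    show "\<exists>S\<subseteq>E. countable S \<and> UNIV = \<Union>S" for i :: int
    proof (intro exI conjI)
      have "UNIV \<in> sets \<mu>" "UNIV \<in> sets \<nu>"
        using sets.top[of \<mu>] sets.top[of \<nu>] by (simp_all add: space_mu space_nu)
      then show "{UNIV \<times> UNIV} \<subseteq> E" unfolding E_def by blast
    qed auto
  qed auto
  finally have sets_law: "sets law = sigma_sets UNIV P"
    by simp
  have UNIV_in: "UNIV \<in> sets \<mu>" "UNIV \<in> sets \<nu>"
    using sets.top[of \<mu>] sets.top[of \<nu>] by (simp_all add: space_mu space_nu)
  have P_box: "\<exists>J A B. finite J \<and> (\<forall>j. A j \<in> sets \<mu>) \<and> (\<forall>j. B j \<in> sets \<nu>)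
      \<and> X = {c. \<forall>j\<in>J. fst (c j) \<in> A j \<and> snd (c j) \<in> B j}" if "X \<in> P" for X
  proof -
    from that obtain C J where J: "finite J" and C: "C \<in> Pi J (\<lambda>_. E)"
      and X: "X = {f. \<forall>i\<in>J. f i \<in> C i}"
      by (auto simp: P_def)
    \<comment> \<open>A member of \<open>P\<close> restricts its sets only on \<open>J\<close>; they
      are extended to all indices because \<open>box\<close> asks for measurability
      everywhere.\<close>
    have "\<forall>j. \<exists>a b. a \<in> sets \<mu> \<and> b \<in> sets \<nu> \<and> (j \<in> J \<longrightarrow> C j = a \<times> b)"
    proof
      fix j show "\<exists>a b. a \<in> sets \<mu> \<and> b \<in> sets \<nu> \<and> (j \<in> J \<longrightarrow> C j = a \<times> b)"
      proof (cases "j \<in> J")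
        case True
        with C have "C j \<in> E" by auto
        then show ?thesis by (auto simp: E_def)
      qed auto
    qed
    then obtain A B where "\<And>j. A j \<in> sets \<mu>" "\<And>j. B j \<in> sets \<nu>" "\<And>j. j \<in> J \<Longrightarrow> C j = A j \<times> B j"
      by metis
    with J X show ?thesis
      by (intro exI[of _ J] exI[of _ A] exI[of _ B]) (auto simp: mem_Times_iff)
  qed
  have box_P: "{c. \<forall>j\<in>J. c j \<in> A j \<times> B j} \<in> P"
    if "finite J" "\<And>j. j \<in> J \<Longrightarrow> A j \<in> sets \<mu>" "\<And>j. j \<in> J \<Longrightarrow> B j \<in> sets \<nu>" for J A B
    unfolding P_def using that
    by (intro CollectI exI[of _ "\<lambda>j. A j \<times> B j"] exI[of _ J]) (auto simp: E_def)
  show ?thesis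
  proof (rule measure_eqI_generator_eq[where \<Omega>=UNIV and E=P and A="\<lambda>_. UNIV"])
    show "Int_stable P"
    proof (rule Int_stableI)
      fix X Y assume "X \<in> P" "Y \<in> P"
      obtain J A B where 1: "finite J" "\<forall>j. A j \<in> sets \<mu>" "\<forall>j. B j \<in> sets \<nu>"
        "X = {c. \<forall>j\<in>J. fst (c j) \<in> A j \<and> snd (c j) \<in> B j}"
        using P_box[OF \<open>X \<in> P\<close>] by blast
      obtain K C D where 2: "finite K" "\<forall>j. C j \<in> sets \<mu>" "\<forall>j. D j \<in> sets \<nu>"
        "Y = {c. \<forall>j\<in>K. fst (c j) \<in> C j \<and> snd (c j) \<in> D j}"
        using P_box[OF \<open>Y \<in> P\<close>] by blast
      let ?A = "\<lambda>j. (if j \<in> J then A j else UNIV) \<inter> (if j \<in> K then C j else UNIV)"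
      let ?B = "\<lambda>j. (if j \<in> J then B j else UNIV) \<inter> (if j \<in> K then D j else UNIV)"
      have "X \<inter> Y = {c. \<forall>j\<in>J \<union> K. c j \<in> ?A j \<times> ?B j}"
        unfolding 1 2 by (auto simp: mem_Times_iff)
      also have "\<dots> \<in> P"
        using 1 2 UNIV_in by (intro box_P sets.Int) auto
      finally show "X \<inter> Y \<in> P" .
    qed
    show "emeasure L X = emeasure law X" if "X \<in> P" for X
      using P_box[OF that] box emeasure_law_box by auto
    show "range (\<lambda>_::nat. UNIV) \<subseteq> P"
      using box_P[of "{}"] by auto
    show "emeasure L UNIV \<noteq> \<infinity>" for i :: nat
      using box[of "{}" "\<lambda>_. {}" "\<lambda>_. {}"] by simp
  qed (use L sets_law in auto)
qed

lemma measurable_into_lawI: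
  assumes "\<And>n. (\<lambda>w. fst (Z w n)) \<in> S \<rightarrow>\<^sub>M \<mu>" "\<And>n. (\<lambda>w. snd (Z w n)) \<in> S \<rightarrow>\<^sub>M \<nu>"
  shows "Z \<in> S \<rightarrow>\<^sub>M law"
proof -
  have "(\<lambda>w. (fst (Z w n), snd (Z w n))) \<in> S \<rightarrow>\<^sub>M \<mu> \<Otimes>\<^sub>M \<nu>" for n
    using assms by (intro measurable_Pair)
  then have "(\<lambda>w. \<lambda>n\<in>UNIV. Z w n) \<in> S \<rightarrow>\<^sub>M law"
    by (intro measurable_restrict) simp
  moreover have "(\<lambda>w. \<lambda>n\<in>UNIV. Z w n) = Z"
    by (simp add: fun_eq_iff)
  ultimately show ?thesis by (simp only:)
qed

text \<open>All components are independent, so the firsts and the seconds may be permuted by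
  different bijections. This is needed because a step between antidiagonals shifts carriers but not
  sites, and because reflecting a row moves even and odd sites differently.\<close>

lemma distr_law_reindex:
  assumes f: "bij f" and g: "bij g"
  shows "distr law law (\<lambda>c k. (fst (c (f k)), snd (c (g k)))) = law"
    and "(\<lambda>c k. (fst (c (f k)), snd (c (g k)))) \<in> law \<rightarrow>\<^sub>M law"
proof -
  show m: "(\<lambda>c k. (fst (c (f k)), snd (c (g k)))) \<in> law \<rightarrow>\<^sub>M law"
    by (rule measurable_into_lawI) measurable
  show "distr law law (\<lambda>c k. (fst (c (f k)), snd (c (g k)))) = law"
  proof (rule eq_lawI)
    fix J :: "int set" and A :: "int \<Rightarrow> 'a set" and B :: "int \<Rightarrow> 'b set"
    assume J: "finite J" and A: "\<And>j. A j \<in> sets \<mu>" and B: "\<And>j. B j \<in> sets \<nu>"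
    have UNIV_in: "UNIV \<in> sets \<mu>" "UNIV \<in> sets \<nu>"
      using sets.top[of \<mu>] sets.top[of \<nu>] by (simp_all add: space_mu space_nu)
    have one: "emeasure \<mu> UNIV = 1" "emeasure \<nu> UNIV = 1"
      using mu.emeasure_space_1 nu.emeasure_space_1 by (simp_all add: space_mu space_nu)
    \<comment> \<open>One index set serves both components; each is left free at the indices that
      only the other one needs.\<close>
    let ?K = "f ` J \<union> g ` J"
    let ?A = "\<lambda>i. if i \<in> f ` J then A (inv f i) else UNIV"
    let ?B = "\<lambda>i. if i \<in> g ` J then B (inv g i) else UNIV"
    note [simp] = inv_f_f[OF bij_is_inj[OF f]] inv_f_f[OF bij_is_inj[OF g]]
    have "emeasure (distr law law (\<lambda>c k. (fst (c (f k)), snd (c (g k)))))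
        {c. \<forall>j\<in>J. fst (c j) \<in> A j \<and> snd (c j) \<in> B j}
      = emeasure law {c. \<forall>j\<in>J. fst (c (f j)) \<in> A j \<and> snd (c (g j)) \<in> B j}"
      using sets_law_box[OF J A B] by (subst emeasure_distr[OF m]) (auto intro!: arg_cong[where f="emeasure law"])
    also have "{c. \<forall>j\<in>J. fst (c (f j)) \<in> A j \<and> snd (c (g j)) \<in> B j}
        = {c. \<forall>i\<in>?K. fst (c i) \<in> ?A i \<and> snd (c i) \<in> ?B i}"
    proof (rule Collect_cong)
      fix c :: "int \<Rightarrow> 'a \<times> 'b"
      have "(\<forall>i\<in>?K. fst (c i) \<in> ?A i) \<longleftrightarrow> (\<forall>i\<in>f ` J. fst (c i) \<in> A (inv f i))"
        by (smt (verit, best) UNIV_I UnCI)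
      moreover have "(\<forall>i\<in>?K. snd (c i) \<in> ?B i) \<longleftrightarrow> (\<forall>i\<in>g ` J. snd (c i) \<in> B (inv g i))"
        by (smt (verit, best) UNIV_I UnCI)
      ultimately show "(\<forall>j\<in>J. fst (c (f j)) \<in> A j \<and> snd (c (g j)) \<in> B j)
          \<longleftrightarrow> (\<forall>i\<in>?K. fst (c i) \<in> ?A i \<and> snd (c i) \<in> ?B i)"
        unfolding ball_conj_distrib by (simp only:) simp
    qed
    also have "emeasure law \<dots> = (\<Prod>i\<in>?K. emeasure \<mu> (?A i)) * (\<Prod>i\<in>?K. emeasure \<nu> (?B i))"
      using J A B UNIV_in by (intro emeasure_law_box) auto
    also have "(\<Prod>i\<in>?K. emeasure \<mu> (?A i)) = (\<Prod>i\<in>f ` J. emeasure \<mu> (A (inv f i)))"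
      using J by (intro prod.mono_neutral_cong_right) (auto simp: one)
    also have "\<dots> = (\<Prod>j\<in>J. emeasure \<mu> (A j))"
      using f by (subst prod.reindex) (auto simp: bij_is_inj inj_on_def bij_def)
    also have "(\<Prod>i\<in>?K. emeasure \<nu> (?B i)) = (\<Prod>i\<in>g ` J. emeasure \<nu> (B (inv g i)))"
      using J by (intro prod.mono_neutral_cong_right) (auto simp: one)
    also have "\<dots> = (\<Prod>j\<in>J. emeasure \<nu> (B j))"
      using g by (subst prod.reindex) (auto simp: bij_is_inj inj_on_def bij_def)
    finally show "emeasure (distr law law (\<lambda>c k. (fst (c (f k)), snd (c (g k)))))
        {c. \<forall>j\<in>J. fst (c j) \<in> A j \<and> snd (c j) \<in> B j}
      = (\<Prod>j\<in>J. emeasure \<mu> (A j)) * (\<Prod>j\<in>J. emeasure \<nu> (B j))" .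
  qed simp
qed

text \<open>Separate index sets for the two components allow a cut through the middle of a pair.
  Splicing two independent rows gives a row of the same law, and this converts "depends only on"
  into independence.\<close>

definition splice :: "int set \<Rightarrow> int set \<Rightarrow> (int \<Rightarrow> 'a \<times> 'b) \<Rightarrow> (int \<Rightarrow> 'a \<times> 'b) \<Rightarrow> int \<Rightarrow> 'a \<times> 'b" where
  "splice I K c d k = (fst (if k \<in> I then c k else d k), snd (if k \<in> K then c k else d k))"

lemma measurable_splice: "(\<lambda>p. splice I K (fst p) (snd p)) \<in> law \<Otimes>\<^sub>M law \<rightarrow>\<^sub>M law"
proof (rule measurable_into_lawI)
  show "(\<lambda>w. fst (splice I K (fst w) (snd w) n)) \<in> law \<Otimes>\<^sub>M law \<rightarrow>\<^sub>M \<mu>" for n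
    by (cases "n \<in> I") (simp_all add: splice_def)
  show "(\<lambda>w. snd (splice I K (fst w) (snd w) n)) \<in> law \<Otimes>\<^sub>M law \<rightarrow>\<^sub>M \<nu>" for n
    by (cases "n \<in> K") (simp_all add: splice_def)
qed

text \<open>At each index and component exactly one of the two copies is constrained, so the two box
  probabilities multiply to that of the original box.\<close>

lemma distr_law_splice:
  "distr (law \<Otimes>\<^sub>M law) law (\<lambda>p. splice I K (fst p) (snd p)) = law"
proof (rule eq_lawI)
  fix J :: "int set" and A :: "int \<Rightarrow> 'a set" and B :: "int \<Rightarrow> 'b set"
  assume J: "finite J" and A: "\<And>j. A j \<in> sets \<mu>" and B: "\<And>j. B j \<in> sets \<nu>"
  have UNIV_in: "UNIV \<in> sets \<mu>" "UNIV \<in> sets \<nu>"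
    using sets.top[of \<mu>] sets.top[of \<nu>] by (simp_all add: space_mu space_nu)
  have one: "emeasure \<mu> UNIV = 1" "emeasure \<nu> UNIV = 1"
    using mu.emeasure_space_1 nu.emeasure_space_1 by (simp_all add: space_mu space_nu)
  let ?A = "\<lambda>j. if j \<in> I then A j else UNIV" and ?A' = "\<lambda>j. if j \<in> I then UNIV else A j"
  let ?B = "\<lambda>j. if j \<in> K then B j else UNIV" and ?B' = "\<lambda>j. if j \<in> K then UNIV else B j"
  let ?X = "{c. \<forall>j\<in>J. fst (c j) \<in> ?A j \<and> snd (c j) \<in> ?B j}"
  let ?Y = "{c. \<forall>j\<in>J. fst (c j) \<in> ?A' j \<and> snd (c j) \<in> ?B' j}"
  have "emeasure (distr (law \<Otimes>\<^sub>M law) law (\<lambda>p. splice I K (fst p) (snd p)))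
      {c. \<forall>j\<in>J. fst (c j) \<in> A j \<and> snd (c j) \<in> B j} = emeasure (law \<Otimes>\<^sub>M law) (?X \<times> ?Y)"
    using sets_law_box[OF J A B]
    by (subst emeasure_distr[OF measurable_splice])
       (auto intro!: arg_cong[where f="emeasure (law \<Otimes>\<^sub>M law)"]
         simp: splice_def space_pair_measure split: if_splits)
  also have "\<dots> = emeasure law ?X * emeasure law ?Y"
    using J A B UNIV_in by (intro law.P.emeasure_pair_measure_Times sets_law_box) auto
  also have "\<dots> = ((\<Prod>j\<in>J. emeasure \<mu> (?A j)) * (\<Prod>j\<in>J. emeasure \<nu> (?B j))) *
      ((\<Prod>j\<in>J. emeasure \<mu> (?A' j)) * (\<Prod>j\<in>J. emeasure \<nu> (?B' j)))"
    using A B UNIV_in J by (intro arg_cong2[where f="(*)"] emeasure_law_box) auto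
  also have "\<dots> = (\<Prod>j\<in>J. emeasure \<mu> (?A j) * emeasure \<mu> (?A' j)) *
      (\<Prod>j\<in>J. emeasure \<nu> (?B j) * emeasure \<nu> (?B' j))"
    by (simp add: prod.distrib mult_ac)
  also have "\<dots> = (\<Prod>j\<in>J. emeasure \<mu> (A j)) * (\<Prod>j\<in>J. emeasure \<nu> (B j))"
    by (intro arg_cong2[where f="(*)"] prod.cong) (auto simp: one)
  finally show "emeasure (distr (law \<Otimes>\<^sub>M law) law (\<lambda>p. splice I K (fst p) (snd p)))
      {c. \<forall>j\<in>J. fst (c j) \<in> A j \<and> snd (c j) \<in> B j}
    = (\<Prod>j\<in>J. emeasure \<mu> (A j)) * (\<Prod>j\<in>J. emeasure \<nu> (B j))" .
qed simp

text \<open>On a spliced row \<open>S\<close> sees only the first copy and \<open>T\<close> only the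
  second, so the intersection pulls back to the rectangle \<open>S \<times> T\<close>.\<close>

lemma emeasure_law_Int_split:
  assumes S: "S \<in> sets law" and T: "T \<in> sets law"
    and dS: "\<And>c d. splice I K c d \<in> S \<longleftrightarrow> c \<in> S"
    and dT: "\<And>c d. splice I K c d \<in> T \<longleftrightarrow> d \<in> T"
  shows "emeasure law (S \<inter> T) = emeasure law S * emeasure law T"
proof -
  have "emeasure law (S \<inter> T)
      = emeasure (distr (law \<Otimes>\<^sub>M law) law (\<lambda>p. splice I K (fst p) (snd p))) (S \<inter> T)"
    by (simp only: distr_law_splice)
  also have "\<dots> = emeasure (law \<Otimes>\<^sub>M law) (S \<times> T)"
    using S T by (subst emeasure_distr[OF measurable_splice])
      (auto intro!: arg_cong[where f="emeasure (law \<Otimes>\<^sub>M law)"] simp: dS dT space_pair_measure)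
  also have "\<dots> = emeasure law S * emeasure law T"
    using S T by (rule law.P.emeasure_pair_measure_Times)
  finally show ?thesis .
qed

end

section \<open>Solutions of the lattice equations\<close>

text \<open>A single site followed upwards in time; \<open>v t\<close> is the carrier that enters it
  from the left at time \<open>t\<close>.\<close>

primrec column :: "('x \<times> 'u \<Rightarrow> 'x \<times> 'u) \<Rightarrow> 'x \<Rightarrow> (nat \<Rightarrow> 'u) \<Rightarrow> nat \<Rightarrow> 'x" where
  "column G a v 0 = a"
| "column G a v (Suc t) = fst (G (column G a v t, v t))"

text \<open>The stream entering column \<open>i\<close> of a quadrant with bottom row
  \<open>h\<close> and left boundary \<open>v\<close>. The recursion runs over space, so each stage
  is a whole function of time.\<close>

primrec carriers :: "('x \<times> 'u \<Rightarrow> 'x \<times> 'u) \<Rightarrow> (nat \<Rightarrow> 'x) \<Rightarrow> (nat \<Rightarrow> 'u) \<Rightarrow> nat \<Rightarrow> nat \<Rightarrow> 'u" where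
  "carriers G h v 0 = v"
| "carriers G h v (Suc i) =
    (\<lambda>t. snd (G (column G (h i) (carriers G h v i) t, carriers G h v i t)))"

text \<open>Keep the solution of \<open>x\<close> at negative times, use that of \<open>y\<close> at sites up to \<open>k\<close> from time 0 on,
  and fill the remaining quadrant by running the local maps from its two boundaries.\<close>

lemma sol1_glue:
  assumes solx: "sol1 G x xs us" and soly: "sol1 G y ys vs"
    and agree: "\<And>n. n \<le> k \<Longrightarrow> x n = y n"
    and step: "\<And>n t a b. P n t a \<Longrightarrow> Q (n - 1) t b \<Longrightarrow>
      P n (t + 1) (fst (G (a, b))) \<and> Q n t (snd (G (a, b)))"
    and Px: "\<And>n t. P n t (xs n t)" "\<And>n t. Q n t (us n t)"
    and Py: "\<And>n t. P n t (ys n t)" "\<And>n t. Q n t (vs n t)"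
  obtains zs ws where "sol1 G x zs ws" "\<And>n t. P n t (zs n t)" "\<And>n t. Q n t (ws n t)"
    "\<And>n. n \<le> k \<Longrightarrow> ws n 0 = vs n 0"
proof -
  \<comment> \<open>The quadrant starts at site \<open>k + 1\<close>: its bottom row is
    \<open>x\<close>, its left boundary the carriers that leave site \<open>k\<close> in the second
    solution.\<close>
  define U where "U = carriers G (\<lambda>i. x (k + 1 + int i)) (\<lambda>t. vs k (int t))"
  \<comment> \<open>Sites come from \<open>xs\<close> up to time 0 but carriers only up to time -1,
    since a cell at time -1 writes a carrier of time -1 and a site of time 0.\<close>
  define zs where "zs n t = (if t \<le> 0 then xs n t else if n \<le> k then ys n t
    else column G (x n) (U (nat (n - k - 1))) (nat t))" for n t
  define ws where "ws n t = (if t < 0 then us n t else if n \<le> k then vs n t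
    else U (nat (n - k)) (nat t))" for n t
  have xeq: "G (xs n t, us (n - 1) t) = (xs n (t + 1), us n t)" "xs n 0 = x n" for n t
    using solx by (auto simp: sol1_def)
  have yeq: "G (ys n t, vs (n - 1) t) = (ys n (t + 1), vs n t)" "ys n 0 = y n" for n t
    using soly by (auto simp: sol1_def)
  have zs_left: "zs n t = ys n t" if "t \<ge> 0" "n \<le> k" for n t
    using that agree[of n] xeq(2)[of n] yeq(2)[of n] by (cases "t = 0") (auto simp: zs_def)
  have zs_right: "zs n t = column G (x n) (U (nat (n - k - 1))) (nat t)" if "t \<ge> 0" "n > k" for n t
    using that xeq(2)[of n] by (cases "t = 0") (auto simp: zs_def)
  have ws_right: "ws (n - 1) t = U (nat (n - k - 1)) (nat t)" if "t \<ge> 0" "n > k" for n t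
  proof (cases "n = k + 1")
    case True
    with that show ?thesis by (simp add: ws_def U_def)
  next
    case False
    with that show ?thesis by (auto simp: ws_def algebra_simps)
  qed
  have eq: "G (zs n t, ws (n - 1) t) = (zs n (t + 1), ws n t)" for n t
  proof (cases "t < 0")
    case True
    then show ?thesis using xeq(1)[of n t] by (simp add: zs_def ws_def)
  next
    case t: False
    show ?thesis
    proof (cases "n \<le> k")
      case True
      with t show ?thesis using yeq(1)[of n t] by (simp add: zs_left ws_def)
    next
      case n: False
      let ?i = "nat (n - k - 1)"
      have "nat (t + 1) = Suc (nat t)" using t by simp
      then have "zs n (t + 1) = fst (G (column G (x n) (U ?i) (nat t), U ?i (nat t)))"
        using t n by (simp add: zs_right)
      moreover have "nat (n - k) = Suc ?i" "k + 1 + int ?i = n" using n by auto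
      then have "ws n t = snd (G (column G (x n) (U ?i) (nat t), U ?i (nat t)))"
        using t n by (simp add: ws_def U_def)
      ultimately show ?thesis
        using t n by (simp add: zs_right ws_right)
    qed
  qed
  have zs0: "zs n 0 = x n" for n by (simp add: zs_def xeq)
  \<comment> \<open>\<open>P\<close> and \<open>Q\<close> spread through the quadrant column by
    column, and upwards inside each column. They will stand for the parity tags.\<close>
  have right: "\<forall>t. P (k + 1 + int i) (int t) (zs (k + 1 + int i) (int t))
      \<and> Q (k + 1 + int i) (int t) (ws (k + 1 + int i) (int t))" for i
  proof (induction i)
    have main: "\<forall>t. P n (int t) (zs n (int t)) \<and> Q n (int t) (ws n (int t))"
      if Q: "\<forall>t. Q (n - 1) (int t) (ws (n - 1) (int t))" for n
    proof -
      have P: "P n (int t) (zs n (int t))" for t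
      proof (induction t)
        case 0
        show ?case using Px(1)[of n 0] by (simp add: zs_def)
      next
        case (Suc t)
        then show ?case using step[OF Suc.IH Q[rule_format]] eq[of n "int t"] by (simp add: add.commute)
      qed
      then show ?thesis using step[of n] Q eq[of n] by (metis snd_conv)
    qed
    {
      case 0
      show ?case by (rule main) (use Py(2)[of k] in \<open>simp add: ws_def\<close>)
    next
      case (Suc i)
      then show ?case
        using main[of "k + 1 + int (Suc i)"] by (simp add: algebra_simps)
    }
  qed
  show thesis
  proof (rule that[of zs ws])
    show "sol1 G x zs ws" using eq zs0 by (simp add: sol1_def)
    show "P n t (zs n t)" for n t
    proof (cases "t \<le> 0 \<or> n \<le> k")
      case True
      then show ?thesis using Px(1)[of n t] Py(1)[of n t] by (auto simp: zs_def)
    next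
      case False
      then show ?thesis using right[of "nat (n - k - 1)", rule_format, of "nat t"] by simp
    qed
    show "Q n t (ws n t)" for n t
    proof (cases "t < 0 \<or> n \<le> k")
      case True
      then show ?thesis using Px(2)[of n t] Py(2)[of n t] by (auto simp: ws_def)
    next
      case False
      then show ?thesis using right[of "nat (n - k - 1)", rule_format, of "nat t"] by simp
    qed
    show "ws n 0 = vs n 0" if "n \<le> k" for n using that by (simp add: ws_def)
  qed
qed

text \<open>A half turn of the lattice exchanges inputs and outputs of every cell, which an
  involution permits. Cell \<open>(n, t)\<close> goes to cell \<open>(- n, - t - 1)\<close>; this
  dictates the offsets of the carriers.\<close>

lemma sol1_reflect:
  assumes "\<And>p. G (G p) = p" "sol1 G x xs us"
  shows "sol1 G (\<lambda>n. x (- n)) (\<lambda>n t. xs (- n) (- t)) (\<lambda>n t. us (- n - 1) (- t - 1))"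
  unfolding sol1_def
proof (intro conjI allI)
  fix n t
  have "G (xs (- n) (- t - 1), us (- n - 1) (- t - 1)) = (xs (- n) (- t - 1 + 1), us (- n) (- t - 1))"
    using assms(2) unfolding sol1_def by blast
  then have "G (xs (- n) (- t), us (- n) (- t - 1)) = (xs (- n) (- t - 1), us (- n - 1) (- t - 1))"
    using assms(1) by (metis diff_add_cancel)
  moreover have "- (n - 1) - 1 = - n" "- (t + 1) = - t - 1" by auto
  ultimately show "G (xs (- n) (- t), us (- (n - 1) - 1) (- t - 1))
      = (xs (- n) (- (t + 1)), us (- n - 1) (- t - 1))"
    by (simp only:)
qed (use assms(2) in \<open>simp add: sol1_def\<close>)

text \<open>Tagged by the parity of the cell, \<open>F\<close> and its inverse form a single involution, so a type II
  solution is a type I solution over the sum types whose tags alternate as a checkerboard.\<close>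

fun tagged :: "('x \<times> 'u \<Rightarrow> 'xt \<times> 'ut) \<Rightarrow> ('x + 'xt) \<times> ('u + 'ut) \<Rightarrow> ('x + 'xt) \<times> ('u + 'ut)" where
  "tagged F (Inl a, Inl b) = map_prod Inr Inr (F (a, b))"
| "tagged F (Inr a, Inr b) = map_prod Inl Inl (inv F (a, b))"
| "tagged F p = p"

lemma tagged_involution:
  assumes "bij F"
  shows "tagged F (tagged F p) = p"
proof (cases "(F, p)" rule: tagged.cases)
  case (1 F' a b)
  then show ?thesis using assms
    by (cases "F (a, b)") (metis Pair_inject bij_is_inj inv_f_f map_prod_simp tagged.simps(1,2))
next
  case (2 F' a b)
  then show ?thesis using assms
    by (cases "inv F (a, b)") (metis Pair_inject bij_is_surj surj_f_inv_f map_prod_simp tagged.simps(1,2))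
qed auto

lemma isl_tagged:
  "isl a = isl b \<Longrightarrow> isl (fst (tagged F (a, b))) = (\<not> isl a)"
  "isl a = isl b \<Longrightarrow> isl (snd (tagged F (a, b))) = (\<not> isl a)"
  by (cases a; cases b; simp)+

text \<open>The last clause of \<open>tagged\<close> fixes pairs with unequal tags, so a solution
  for \<open>tagged F\<close> can have tags that do not alternate; this condition excludes
  it.\<close>

definition checkered :: "(int \<Rightarrow> int \<Rightarrow> 'x + 'xt) \<Rightarrow> (int \<Rightarrow> int \<Rightarrow> 'u + 'ut) \<Rightarrow> bool" where
  "checkered xs us \<longleftrightarrow> (\<forall>n t. isl (xs n t) = even (n + t)) \<and> (\<forall>n t. isl (us n t) = odd (n + t))"

lemma sol2_iff: "sol2 F c xs us \<longleftrightarrow> sol1 (tagged F) (cfg2 c) xs us \<and> checkered xs us"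
proof (intro iffI conjI)
  assume s: "sol2 F c xs us"
  have cell: "if even (n + t) then
        (\<exists>a b. xs n t = Inl a \<and> us (n - 1) t = Inl b \<and>
               xs n (t + 1) = Inr (fst (F (a, b))) \<and> us n t = Inr (snd (F (a, b))))
      else
        (\<exists>a b. xs n t = Inr a \<and> us (n - 1) t = Inr b \<and>
               xs n (t + 1) = Inl (fst (inv F (a, b))) \<and> us n t = Inl (snd (inv F (a, b))))" for n t
    using s unfolding sol2_def by blast
  show "sol1 (tagged F) (cfg2 c) xs us"
    unfolding sol1_def
  proof (intro conjI allI)
    show "tagged F (xs n t, us (n - 1) t) = (xs n (t + 1), us n t)" for n t
      using cell[of n t] by (cases "even (n + t)") (auto simp: map_prod_def split_beta)
    show "xs n 0 = cfg2 c n" for n using s by (simp add: sol2_def)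
  qed
  show "checkered xs us"
    unfolding checkered_def
  proof (intro conjI allI)
    show "isl (xs n t) = even (n + t)" "isl (us n t) = odd (n + t)" for n t
      using cell[of n t] by (cases "even (n + t)"; auto)+
  qed
next
  assume "sol1 (tagged F) (cfg2 c) xs us \<and> checkered xs us"
  then have s: "tagged F (xs n t, us (n - 1) t) = (xs n (t + 1), us n t)" "xs n 0 = cfg2 c n"
    and t: "isl (xs n t) = even (n + t)" "isl (us n t) = odd (n + t)" for n t
    by (auto simp: sol1_def checkered_def)
  have u: "isl (us (n - 1) t) = even (n + t)" for n t
    using t(2)[of "n - 1" t] by simp
  show "sol2 F c xs us"
    unfolding sol2_def
  proof (intro conjI allI)
    fix n t
    show "if even (n + t) then
        (\<exists>a b. xs n t = Inl a \<and> us (n - 1) t = Inl b \<and>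
               xs n (t + 1) = Inr (fst (F (a, b))) \<and> us n t = Inr (snd (F (a, b))))
      else
        (\<exists>a b. xs n t = Inr a \<and> us (n - 1) t = Inr b \<and>
               xs n (t + 1) = Inl (fst (inv F (a, b))) \<and> us n t = Inl (snd (inv F (a, b))))"
    proof (cases "even (n + t)")
      case True
      then obtain a b where "xs n t = Inl a" "us (n - 1) t = Inl b"
        using t(1)[of n t] u[of n t] by (metis isl_def)
      then show ?thesis using True s(1)[of n t] by (auto simp: map_prod_def split_beta)
    next
      case False
      then obtain a b where "xs n t = Inr a" "us (n - 1) t = Inr b"
        using t(1)[of n t] u[of n t] by (metis isl_def sum.exhaust)
      then show ?thesis using False s(1)[of n t] by (auto simp: map_prod_def split_beta)
    qed
  qed (use s in simp)
qed

section \<open>The unique solution: extraction, causality and symmetries\<close>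

lemma solof2_eqI:
  assumes "c \<in> Xstar2 F" "sol2 F c xs us"
  shows "solof2 F c = (xs, us)"
  unfolding solof2_def
  by (rule the1_equality) (use assms in \<open>simp_all add: Xstar2_def\<close>)

lemma sol2_solof2:
  assumes "c \<in> Xstar2 F"
  shows "sol2 F c (fst (solof2 F c)) (snd (solof2 F c))"
  unfolding solof2_def
  by (rule theI'[where P="\<lambda>p. sol2 F c (fst p) (snd p)"]) (use assms in \<open>simp add: Xstar2_def\<close>)

lemma solof1_eqI:
  assumes "x \<in> Xstar1 F" "sol1 F x xs us"
  shows "solof1 F x = (xs, us)"
  unfolding solof1_def
  by (rule the1_equality) (use assms in \<open>simp_all add: Xstar1_def\<close>)

lemma sol1_solof1:
  assumes "x \<in> Xstar1 F"
  shows "sol1 F x (fst (solof1 F x)) (snd (solof1 F x))"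
  unfolding solof1_def
  by (rule theI'[where P="\<lambda>p. sol1 F x (fst p) (snd p)"]) (use assms in \<open>simp add: Xstar1_def\<close>)

text \<open>The glued family solves the equations for \<open>c\<close> but has the time-0 carriers
  of \<open>d\<close> at sites up to \<open>k\<close>. Uniqueness of the solution for
  \<open>c\<close> forces the two to coincide.\<close>

lemma U2_causal:
  assumes c: "c \<in> Xstar2 F" and d: "d \<in> Xstar2 F"
    and agree: "\<And>n. n \<le> k \<Longrightarrow> cfg2 c n = cfg2 d n"
  shows "U2 F k c = U2 F k d"
proof -
  obtain xs us where p: "solof2 F c = (xs, us)" by force
  obtain ys vs where q: "solof2 F d = (ys, vs)" by force
  have solc: "sol1 (tagged F) (cfg2 c) xs us" "checkered xs us"
    using sol2_solof2[OF c] p by (simp_all add: sol2_iff)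
  have sold: "sol1 (tagged F) (cfg2 d) ys vs" "checkered ys vs"
    using sol2_solof2[OF d] q by (simp_all add: sol2_iff)
  obtain zs ws where z: "sol1 (tagged F) (cfg2 c) zs ws"
    "\<And>n t. isl (zs n t) = even (n + t)" "\<And>n t. isl (ws n t) = odd (n + t)"
    and ws: "\<And>n. n \<le> k \<Longrightarrow> ws n 0 = vs n 0"
  \<comment> \<open>Carrying the tags along makes the glued family a type II solution and not merely
    one for \<open>tagged F\<close>.\<close>
  proof (rule sol1_glue[OF solc(1) sold(1) agree,
      where P = "\<lambda>n t a. isl a = even (n + t)" and Q = "\<lambda>n t b. isl b = odd (n + t)"])
    show "isl (fst (tagged F (a, b))) = even (n + (t + 1)) \<and> isl (snd (tagged F (a, b))) = odd (n + t)"
      if "isl a = even (n + t)" "isl b = odd (n - 1 + t)" for n t :: int and a b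
      using that isl_tagged[of a b F] by simp
  qed (use solc(2) sold(2) in \<open>auto simp: checkered_def\<close>)
  have "sol2 F c zs ws" using z by (simp add: sol2_iff checkered_def)
  then have "ws = us" using solof2_eqI[OF c] p by auto
  then show ?thesis using ws[of k] c d p q by (simp add: U2_def)
qed

text \<open>The half turn about site 0 in the pair encoding: site \<open>- (2 k + 1)\<close> is the
  second half of pair \<open>- k - 1\<close>, hence the extra shift in the second component.\<close>

definition reflect2 :: "(int \<Rightarrow> 'x \<times> 'xt) \<Rightarrow> int \<Rightarrow> 'x \<times> 'xt" where
  "reflect2 c k = (fst (c (- k)), snd (c (- k - 1)))"

lemma cfg2_reflect2: "cfg2 (reflect2 c) n = cfg2 c (- n)"
proof (cases "even n")
  case True
  then obtain k where "n = 2 * k" by (rule evenE)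
  moreover from this have "(- n) div 2 = - k" by presburger
  ultimately show ?thesis by (simp add: cfg2_def reflect2_def)
next
  case False
  then obtain k where "n = 2 * k + 1" by (rule oddE)
  moreover from this have "(- n) div 2 = - k - 1" by presburger
  ultimately show ?thesis by (simp add: cfg2_def reflect2_def)
qed

lemma U2_reflect2:
  assumes "bij F" "d \<in> Xstar2 F" "reflect2 d \<in> Xstar2 F"
  shows "U2 F n (reflect2 d) = snd (solof2 F d) (- n - 1) (- 1)"
proof -
  obtain xs us where p: "solof2 F d = (xs, us)" by force
  have "sol1 (tagged F) (cfg2 d) xs us" "checkered xs us"
    using sol2_solof2[OF assms(2)] p by (simp_all add: sol2_iff)
  then have "sol1 (tagged F) (cfg2 (reflect2 d)) (\<lambda>n t. xs (- n) (- t)) (\<lambda>n t. us (- n - 1) (- t - 1))"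
    using sol1_reflect[OF tagged_involution[OF assms(1)], of "cfg2 d" xs us]
    by (simp add: cfg2_reflect2[abs_def])
  moreover have "checkered (\<lambda>n t. xs (- n) (- t)) (\<lambda>n t. us (- n - 1) (- t - 1))"
    using \<open>checkered xs us\<close> by (auto simp: checkered_def)
  ultimately have "sol2 F (reflect2 d) (\<lambda>n t. xs (- n) (- t)) (\<lambda>n t. us (- n - 1) (- t - 1))"
    by (simp add: sol2_iff)
  then have "solof2 F (reflect2 d) = (\<lambda>n t. xs (- n) (- t), \<lambda>n t. us (- n - 1) (- t - 1))"
    by (rule solof2_eqI[OF assms(3)])
  then show ?thesis using p assms(3) by (simp add: U2_def)
qed

text \<open>Translating a solution by one unit in space and time preserves the parity of
  \<open>n + t\<close> and starts it from the row \<open>T2 F c\<close>. At \<open>n = 0\<close>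
  this leads to the same edge as \<open>U2_reflect2\<close>, so \<open>U2 F 0\<close> takes equal
  values at \<open>c\<close> and \<open>reflect2 (T2 F c)\<close>.\<close>

lemma U2_T2:
  assumes "bij F" "c \<in> Xstar2 F" "T2 F c \<in> Xstar2 F"
  shows "U2 F n c = snd (solof2 F (T2 F c)) (n - 1) (- 1)"
proof -
  obtain xs us where p: "solof2 F c = (xs, us)" by force
  have s: "sol1 (tagged F) (cfg2 c) xs us" and ch: "checkered xs us"
    using sol2_solof2[OF assms(2)] p by (simp_all add: sol2_iff)
  have T: "T2 F c k = (projl (xs (2 * k + 1) 1), projr (xs (2 * k + 2) 1))" for k
    using assms(2) p by (simp add: T2_def)
  have "cfg2 (T2 F c) n = xs (n + 1) 1" for n
  proof (cases "even n")
    case True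
    then obtain k where k: "n = 2 * k" by (rule evenE)
    have "isl (xs (2 * k + 1) 1)" using ch by (simp add: checkered_def)
    then show ?thesis using k by (simp add: cfg2_def T)
  next
    case False
    then obtain k where k: "n = 2 * k + 1" by (rule oddE)
    have "\<not> isl (xs (2 * k + 2) 1)" using ch by (simp add: checkered_def)
    then show ?thesis using k by (simp add: cfg2_def T add.assoc)
  qed
  then have cfg: "cfg2 (T2 F c) = (\<lambda>n. xs (n + 1) 1)" by (rule ext)
  have "tagged F (xs (n + 1) (t + 1), us (n - 1 + 1) (t + 1))
      = (xs (n + 1) (t + 1 + 1), us (n + 1) (t + 1))" for n t
    using s[unfolded sol1_def, THEN conjunct1, rule_format, of "n + 1" "t + 1"] by simp
  then have "sol1 (tagged F) (cfg2 (T2 F c)) (\<lambda>n t. xs (n + 1) (t + 1)) (\<lambda>n t. us (n + 1) (t + 1))"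
    unfolding sol1_def cfg by simp
  moreover have "checkered (\<lambda>n t. xs (n + 1) (t + 1)) (\<lambda>n t. us (n + 1) (t + 1))"
    using ch by (simp add: checkered_def) blast
  ultimately have "sol2 F (T2 F c) (\<lambda>n t. xs (n + 1) (t + 1)) (\<lambda>n t. us (n + 1) (t + 1))"
    by (simp add: sol2_iff)
  then have "solof2 F (T2 F c) = (\<lambda>n t. xs (n + 1) (t + 1), \<lambda>n t. us (n + 1) (t + 1))"
    by (rule solof2_eqI[OF assms(3)])
  then show ?thesis using p assms(2) by (simp add: U2_def)
qed

text \<open>This is the cell at site \<open>2 * k\<close>, time 0. The shift built into the dynamics
  puts its output at position \<open>2 * k - 1\<close> of the new row, the second half of pair
  \<open>k - 1\<close>.\<close>

lemma F_cell_T2: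
  assumes "c \<in> Xstar2 F"
  shows "F (fst (c k), Uodd2 F k c) = (snd (T2 F c (k - 1)), Ueven2 F k c)"
proof -
  obtain xs us where p: "solof2 F c = (xs, us)" by force
  have s: "sol2 F c xs us" using sol2_solof2[OF assms] p by simp
  have "\<exists>a b. xs (2 * k) 0 = Inl a \<and> us (2 * k - 1) 0 = Inl b \<and>
      xs (2 * k) (0 + 1) = Inr (fst (F (a, b))) \<and> us (2 * k) 0 = Inr (snd (F (a, b)))"
    using s unfolding sol2_def by (metis add.right_neutral dvd_triv_left)
  moreover have "xs (2 * k) 0 = Inl (fst (c k))"
    using s by (simp add: sol2_def cfg2_def)
  ultimately show ?thesis
    using assms p by (auto simp: T2_def U2_def Uodd2_def Ueven2_def)
qed

section \<open>Independence from causality\<close>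

context product_law
begin

lemma AE_law_splice:
  assumes "AE c in law. P c"
  shows "AE p in law \<Otimes>\<^sub>M law. P (splice I K (fst p) (snd p))"
  by (rule AE_distrD[OF measurable_splice]) (unfold distr_law_splice, rule assms)

lemma splice_empty [simp]: "splice {} {} c d = d"
  by (simp add: fun_eq_iff splice_def)

text \<open>The splitting principle for random variables. The dependence is required only almost
  surely, because carriers are controlled only when the rows compared lie in
  \<open>Xstar2 F\<close>.\<close>

lemma distr_law_Pair_split:
  assumes f: "f \<in> law \<rightarrow>\<^sub>M A" and g: "g \<in> law \<rightarrow>\<^sub>M B"
    and df: "AE p in law \<Otimes>\<^sub>M law. f (splice I K (fst p) (snd p)) = f (fst p)"
    and dg: "AE p in law \<Otimes>\<^sub>M law. g (splice I K (fst p) (snd p)) = g (snd p)"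
  shows "distr law (A \<Otimes>\<^sub>M B) (\<lambda>c. (f c, g c)) = distr law A f \<Otimes>\<^sub>M distr law B g"
proof -
  note [measurable] = f g measurable_splice
  have "prob_space (distr law B g)" by (rule law.P.prob_space_distr) measurable
  then have sf: "sigma_finite_measure (distr law B g)"
    by (simp add: prob_space_imp_sigma_finite)
  have "distr law (A \<Otimes>\<^sub>M B) (\<lambda>c. (f c, g c))
      = distr (distr (law \<Otimes>\<^sub>M law) law (\<lambda>p. splice I K (fst p) (snd p))) (A \<Otimes>\<^sub>M B) (\<lambda>c. (f c, g c))"
    by (simp only: distr_law_splice)
  also have "\<dots> = distr (law \<Otimes>\<^sub>M law) (A \<Otimes>\<^sub>M B)
      (\<lambda>p. (f (splice I K (fst p) (snd p)), g (splice I K (fst p) (snd p))))"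
    by (subst distr_distr) (measurable, simp add: comp_def)
  also have "\<dots> = distr (law \<Otimes>\<^sub>M law) (A \<Otimes>\<^sub>M B) (\<lambda>p. (f (fst p), g (snd p)))"
  proof (rule distr_cong_AE)
    show "AE p in law \<Otimes>\<^sub>M law. (f (splice I K (fst p) (snd p)), g (splice I K (fst p) (snd p)))
        = (f (fst p), g (snd p))"
      using df dg by eventually_elim simp
  qed measurable
  also have "\<dots> = distr law A f \<Otimes>\<^sub>M distr law B g"
    by (subst pair_measure_distr[OF f g sf]) (simp add: case_prod_unfold)
  finally show ?thesis .
qed

lemma distr_law_fst: "distr law \<mu> (\<lambda>c. fst (c n)) = \<mu>"
proof (rule measure_eqI)
  fix A assume "A \<in> sets (distr law \<mu> (\<lambda>c. fst (c n)))"
  then have A: "A \<in> sets \<mu>" by simp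
  have "emeasure (distr law \<mu> (\<lambda>c. fst (c n))) A
      = emeasure law {c. \<forall>j\<in>{n}. fst (c j) \<in> A \<and> snd (c j) \<in> space \<nu>}"
    using A by (subst emeasure_distr) (auto simp: space_nu vimage_def)
  also have "\<dots> = emeasure \<mu> A"
    using A by (subst emeasure_law_box) (auto simp: nu.emeasure_space_1)
  finally show "emeasure (distr law \<mu> (\<lambda>c. fst (c n))) A = emeasure \<mu> A" .
qed simp

lemma distr_law_snd: "distr law \<nu> (\<lambda>c. snd (c n)) = \<nu>"
proof (rule measure_eqI)
  fix A assume "A \<in> sets (distr law \<nu> (\<lambda>c. snd (c n)))"
  then have A: "A \<in> sets \<nu>" by simp
  have "emeasure (distr law \<nu> (\<lambda>c. snd (c n))) A
      = emeasure law {c. \<forall>j\<in>{n}. fst (c j) \<in> space \<mu> \<and> snd (c j) \<in> A}"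
    using A by (subst emeasure_distr) (auto simp: space_mu vimage_def)
  also have "\<dots> = emeasure \<nu> A"
    using A by (subst emeasure_law_box) (auto simp: mu.emeasure_space_1)
  finally show "emeasure (distr law \<nu> (\<lambda>c. snd (c n))) A = emeasure \<nu> A" .
qed simp

end

lemma cfg2_eq_iff:
  "cfg2 c (2 * k) = cfg2 d (2 * k) \<longleftrightarrow> fst (c k) = fst (d k)"
  "cfg2 c (2 * k + 1) = cfg2 d (2 * k + 1) \<longleftrightarrow> snd (c k) = snd (d k)"
  by (simp_all add: cfg2_def)

lemma cfg2_agreeI:
  assumes "\<And>k. 2 * k \<le> m \<Longrightarrow> fst (c k) = fst (d k)" "\<And>k. 2 * k + 1 \<le> m \<Longrightarrow> snd (c k) = snd (d k)"
    and "n \<le> m"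
  shows "cfg2 c n = cfg2 d n"
proof (cases "even n")
  case True
  then obtain k where "n = 2 * k" by (rule evenE)
  with assms show ?thesis by (simp add: cfg2_eq_iff)
next
  case False
  then obtain k where "n = 2 * k + 1" by (rule oddE)
  with assms show ?thesis by (simp only: cfg2_eq_iff)
qed

section \<open>Type II model: from invariance of the row law to the local balance\<close>

locale type2_model = product_law \<mu> \<mu>t
  for \<mu> :: "'y::polish_space measure" and \<mu>t :: "'yt::polish_space measure" +
  fixes F :: "'y \<times> 'v::polish_space \<Rightarrow> 'yt \<times> 'vt::polish_space"
  assumes F_borel [measurable]: "F \<in> borel \<rightarrow>\<^sub>M borel" and bij_F: "bij F"
    and sets_mu [measurable_cong]: "sets \<mu> = sets borel"
    and sets_mut [measurable_cong]: "sets \<mu>t = sets borel"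
    and star: "emeasure law (Xstar2 F) = 1"
    and T2_meas [measurable]: "T2 F \<in> law \<rightarrow>\<^sub>M law"
    and Uodd2_meas [measurable]: "\<And>n. Uodd2 F n \<in> law \<rightarrow>\<^sub>M borel"
    and Ueven2_meas [measurable]: "\<And>n. Ueven2 F n \<in> law \<rightarrow>\<^sub>M borel"
begin

lemma AE_star: "AE c in law. c \<in> Xstar2 F"
proof -
  \<comment> \<open>A set outside the sigma-algebra gets \<open>emeasure\<close> 0, so the value 1
    entails measurability.\<close>
  have "Xstar2 F \<in> sets law" using star emeasure_notin_sets[of "Xstar2 F" law] by fastforce
  then show ?thesis
    using star by (subst law.P.AE_in_set_eq_1) (auto simp: law.P.emeasure_eq_measure)
qed

lemma F_measurable:
  assumes "sets \<nu> = sets borel" "sets \<nu>t = sets borel"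
  shows "F \<in> \<mu> \<Otimes>\<^sub>M \<nu> \<rightarrow>\<^sub>M \<mu>t \<Otimes>\<^sub>M \<nu>t"
proof -
  have "sets (\<mu> \<Otimes>\<^sub>M \<nu>) = sets borel" "sets (\<mu>t \<Otimes>\<^sub>M \<nu>t) = sets borel"
    using sets_pair_measure_cong[OF sets_mu assms(1)] sets_pair_measure_cong[OF sets_mut assms(2)]
    unfolding borel_prod by simp_all
  with F_borel show ?thesis using measurable_cong_sets by blast
qed

lemma AE_splice_star: "AE p in law \<Otimes>\<^sub>M law. splice I K (fst p) (snd p) \<in> Xstar2 F \<and> snd p \<in> Xstar2 F"
proof -
  have "AE p in law \<Otimes>\<^sub>M law. splice {} {} (fst p) (snd p) \<in> Xstar2 F"
    by (rule AE_law_splice[OF AE_star])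
  with AE_law_splice[OF AE_star, of I K] show ?thesis
    by eventually_elim simp
qed

text \<open>The carrier entering site 0 ignores all sites from 0 on, by causality. The cut falls
  between two pairs.\<close>

lemma distr_x0_Uodd2:
  "distr law (\<mu> \<Otimes>\<^sub>M borel) (\<lambda>c. (fst (c 0), Uodd2 F 0 c)) = \<mu> \<Otimes>\<^sub>M distr law borel (Uodd2 F 0)"
proof -
  have "distr law (\<mu> \<Otimes>\<^sub>M borel) (\<lambda>c. (fst (c 0), Uodd2 F 0 c))
      = distr law \<mu> (\<lambda>c. fst (c 0)) \<Otimes>\<^sub>M distr law borel (Uodd2 F 0)"
  proof (rule distr_law_Pair_split[where I="{0..}" and K="{0..}"])
    show "AE p in law \<Otimes>\<^sub>M law. Uodd2 F 0 (splice {0..} {0..} (fst p) (snd p)) = Uodd2 F 0 (snd p)"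
      using AE_splice_star[of "{0..}" "{0..}"]
    proof eventually_elim
      case (elim p)
      have "U2 F (- 1) (splice {0..} {0..} (fst p) (snd p)) = U2 F (- 1) (snd p)"
        by (rule U2_causal) (use elim in \<open>auto intro!: cfg2_agreeI[where m="-1"] simp: splice_def\<close>)
      then show ?case by (simp add: Uodd2_def)
    qed
  qed (auto simp: splice_def)
  then show ?thesis by (simp add: distr_law_fst)
qed

text \<open>The carrier leaving site 0 may depend on site 0 but not on site 1. The cut runs through
  pair 0, whence the two different index sets.\<close>

lemma distr_x1_Ueven2:
  "distr law (\<mu>t \<Otimes>\<^sub>M borel) (\<lambda>c. (snd (c 0), Ueven2 F 0 c)) = \<mu>t \<Otimes>\<^sub>M distr law borel (Ueven2 F 0)"
proof -
  have "distr law (\<mu>t \<Otimes>\<^sub>M borel) (\<lambda>c. (snd (c 0), Ueven2 F 0 c))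
      = distr law \<mu>t (\<lambda>c. snd (c 0)) \<Otimes>\<^sub>M distr law borel (Ueven2 F 0)"
  proof (rule distr_law_Pair_split[where I="{1..}" and K="{0..}"])
    show "AE p in law \<Otimes>\<^sub>M law. Ueven2 F 0 (splice {1..} {0..} (fst p) (snd p)) = Ueven2 F 0 (snd p)"
      using AE_splice_star[of "{1..}" "{0..}"]
    proof eventually_elim
      case (elim p)
      have "U2 F 0 (splice {1..} {0..} (fst p) (snd p)) = U2 F 0 (snd p)"
        by (rule U2_causal) (use elim in \<open>auto intro!: cfg2_agreeI[where m=0] simp: splice_def\<close>)
      then show ?case by (simp add: Ueven2_def)
    qed
  qed (auto simp: splice_def)
  then show ?thesis by (simp add: distr_law_snd)
qed

lemma distr_reflect2: "distr law law reflect2 = law" and reflect2_meas [measurable]: "reflect2 \<in> law \<rightarrow>\<^sub>M law"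
proof -
  have "bij (uminus :: int \<Rightarrow> int)" "bij (\<lambda>k :: int. - k - 1)"
    by (rule involuntory_imp_bij, simp)+
  from distr_law_reindex[OF this]
  show "distr law law reflect2 = law" "reflect2 \<in> law \<rightarrow>\<^sub>M law"
    by (simp_all add: reflect2_def[abs_def])
qed

text \<open>Almost surely the output of the cell at site 0 is the pair of
  \<open>distr_x1_Ueven2\<close> read on the row \<open>reflect2 (T2 F c)\<close>. That row has the
  law of \<open>c\<close>, so the outputs are independent just as that pair is.\<close>

lemma invariant_imp_detailed_balance:
  assumes inv: "distr law law (T2 F) = law"
  defines "\<nu> \<equiv> distr law borel (Uodd2 F 0)" and "\<nu>t \<equiv> distr law borel (Ueven2 F 0)"
  shows "distr (\<mu> \<Otimes>\<^sub>M \<nu>) (\<mu>t \<Otimes>\<^sub>M \<nu>t) F = \<mu>t \<Otimes>\<^sub>M \<nu>t"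
proof -
  have sets_nu [measurable_cong]: "sets \<nu> = sets borel" "sets \<nu>t = sets borel"
    by (simp_all add: \<nu>_def \<nu>t_def)
  have [measurable]: "F \<in> \<mu> \<Otimes>\<^sub>M \<nu> \<rightarrow>\<^sub>M \<mu>t \<Otimes>\<^sub>M \<nu>t"
    by (rule F_measurable[OF sets_nu])
  have star_T: "AE c in law. T2 F c \<in> Xstar2 F"
    by (rule AE_distrD[OF T2_meas]) (unfold inv, rule AE_star)
  have star_RT: "AE c in law. reflect2 (T2 F c) \<in> Xstar2 F"
  proof (rule AE_distrD[OF T2_meas])
    show "AE c in distr law law (T2 F). reflect2 c \<in> Xstar2 F"
      unfolding inv by (rule AE_distrD[OF reflect2_meas]) (unfold distr_reflect2, rule AE_star)
  qed
  let ?h = "\<lambda>c. (snd (c (0::int)), Ueven2 F 0 c)"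
  have h: "?h \<in> law \<rightarrow>\<^sub>M \<mu>t \<Otimes>\<^sub>M \<nu>t" by measurable
  have "distr (\<mu> \<Otimes>\<^sub>M \<nu>) (\<mu>t \<Otimes>\<^sub>M \<nu>t) F
      = distr (distr law (\<mu> \<Otimes>\<^sub>M \<nu>) (\<lambda>c. (fst (c 0), Uodd2 F 0 c))) (\<mu>t \<Otimes>\<^sub>M \<nu>t) F"
    using distr_x0_Uodd2 by (simp add: \<nu>_def cong: distr_cong)
  also have "\<dots> = distr law (\<mu>t \<Otimes>\<^sub>M \<nu>t) (\<lambda>c. F (fst (c 0), Uodd2 F 0 c))"
    by (subst distr_distr) (measurable, simp add: comp_def)
  also have "\<dots> = distr law (\<mu>t \<Otimes>\<^sub>M \<nu>t) (\<lambda>c. ?h (reflect2 (T2 F c)))"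
  proof (rule distr_cong_AE)
    show "AE c in law. F (fst (c 0), Uodd2 F 0 c) = ?h (reflect2 (T2 F c))"
      using AE_star star_T star_RT
    proof eventually_elim
      case (elim c)
      have "U2 F 0 c = U2 F 0 (reflect2 (T2 F c))"
        using U2_T2[OF bij_F elim(1,2), of 0] U2_reflect2[OF bij_F elim(2,3), of 0] by simp
      then show ?case
        by (simp add: F_cell_T2[OF elim(1)] Ueven2_def reflect2_def)
    qed
  qed measurable
  also have "\<dots> = distr (distr (distr law law (T2 F)) law reflect2) (\<mu>t \<Otimes>\<^sub>M \<nu>t) ?h"
    by (subst distr_distr, measurable, subst distr_distr, measurable, simp add: comp_def)
  also have "\<dots> = distr law (\<mu>t \<Otimes>\<^sub>M \<nu>t) ?h"
    by (simp only: inv distr_reflect2)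
  also have "\<dots> = \<mu>t \<Otimes>\<^sub>M \<nu>t"
    using distr_x1_Ueven2 by (simp add: \<nu>t_def cong: distr_cong)
  finally show ?thesis .
qed

end

section \<open>Stationary random fields on the lattice\<close>

lemma distr_PiM_sitewise:
  fixes P :: "'a measure" and Q :: "'b measure"
  assumes P: "prob_space P" and Q: "prob_space Q" and F: "F \<in> P \<rightarrow>\<^sub>M Q" and FPQ: "distr P Q F = Q"
  shows "(\<lambda>e n. F (e n)) \<in> (\<Pi>\<^sub>M n\<in>(UNIV :: 'i set). P) \<rightarrow>\<^sub>M (\<Pi>\<^sub>M n\<in>UNIV. Q)"
    and "distr (\<Pi>\<^sub>M n\<in>(UNIV :: 'i set). P) (\<Pi>\<^sub>M n\<in>UNIV. Q) (\<lambda>e n. F (e n)) = (\<Pi>\<^sub>M n\<in>UNIV. Q)"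
proof -
  interpret PP: product_prob_space "\<lambda>_. P" "UNIV :: 'i set"
    using P by (simp add: product_prob_space_def product_prob_space_axioms_def product_sigma_finite_def
      prob_space_imp_sigma_finite)
  interpret QQ: product_prob_space "\<lambda>_. Q" "UNIV :: 'i set"
    using Q by (simp add: product_prob_space_def product_prob_space_axioms_def product_sigma_finite_def
      prob_space_imp_sigma_finite)
  have "(\<lambda>e. \<lambda>n\<in>(UNIV :: 'i set). F (e n)) \<in> (\<Pi>\<^sub>M n\<in>UNIV. P) \<rightarrow>\<^sub>M (\<Pi>\<^sub>M n\<in>UNIV. Q)"
    by (intro measurable_restrict measurable_compose[OF _ F] measurable_component_singleton) simp
  then show m: "(\<lambda>e n. F (e n)) \<in> (\<Pi>\<^sub>M n\<in>(UNIV :: 'i set). P) \<rightarrow>\<^sub>M (\<Pi>\<^sub>M n\<in>UNIV. Q)"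
    by (simp only: restrict_UNIV)
  show "distr (\<Pi>\<^sub>M n\<in>(UNIV :: 'i set). P) (\<Pi>\<^sub>M n\<in>UNIV. Q) (\<lambda>e n. F (e n)) = (\<Pi>\<^sub>M n\<in>UNIV. Q)"
  proof (rule QQ.PiM_eq)
    fix J and A :: "'i \<Rightarrow> 'b set"
    assume J: "finite J" "J \<subseteq> UNIV" and A: "\<And>j. j \<in> J \<Longrightarrow> A j \<in> sets Q"
    have "emeasure (distr (\<Pi>\<^sub>M n\<in>UNIV. P) (\<Pi>\<^sub>M n\<in>UNIV. Q) (\<lambda>e n. F (e n)))
        (prod_emb UNIV (\<lambda>_. Q) J (Pi\<^sub>E J A))
      = emeasure (\<Pi>\<^sub>M n\<in>UNIV. P) {e \<in> space (\<Pi>\<^sub>M n\<in>UNIV. P). \<forall>j\<in>J. e j \<in> F -` A j \<inter> space P}"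
    proof -
      have "prod_emb UNIV (\<lambda>_. Q) J (Pi\<^sub>E J A) \<in> sets (\<Pi>\<^sub>M n\<in>UNIV. Q)"
        using J A by (intro sets_PiM_I) auto
      then show ?thesis
        using measurable_space[OF F]
        by (subst emeasure_distr[OF m])
           (auto intro!: arg_cong[where f="emeasure _"] simp: prod_emb_def space_PiM PiE_iff)
    qed
    also have "\<dots> = (\<Prod>j\<in>J. emeasure P (F -` A j \<inter> space P))"
      using J A F by (intro PP.emeasure_PiM_Collect) auto
    also have "\<dots> = (\<Prod>j\<in>J. emeasure Q (A j))"
    proof (rule prod.cong)
      fix j assume "j \<in> J"
      then show "emeasure P (F -` A j \<inter> space P) = emeasure Q (A j)"
        using A emeasure_distr[OF F, of "A j"] FPQ by simp
    qed simp
    finally show "emeasure (distr (\<Pi>\<^sub>M n\<in>UNIV. P) (\<Pi>\<^sub>M n\<in>UNIV. Q) (\<lambda>e n. F (e n)))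
        (prod_emb UNIV (\<lambda>_. Q) J (Pi\<^sub>E J A)) = (\<Prod>j\<in>J. emeasure Q (A j))" .
  qed simp
qed

text \<open>The inputs of the cells \<open>(n, s - n)\<close> of the antidiagonal \<open>s\<close> determine those of the
  neighbouring antidiagonals.\<close>

definition advance :: "('a \<times> 'b \<Rightarrow> 'c \<times> 'd) \<Rightarrow> (int \<Rightarrow> 'a \<times> 'b) \<Rightarrow> int \<Rightarrow> 'c \<times> 'd" where
  "advance F e n = (fst (F (e n)), snd (F (e (n - 1))))"

definition retreat :: "('a \<times> 'b \<Rightarrow> 'c \<times> 'd) \<Rightarrow> (int \<Rightarrow> 'a \<times> 'b) \<Rightarrow> int \<Rightarrow> 'c \<times> 'd" where
  "retreat G w n = G (fst (w n), snd (w (n + 1)))"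

text \<open>Events that do not look at what lies before the site \<open>l\<close> of the row under construction,
  nor at the carrier entering \<open>l\<close>.\<close>

definition future_event :: "int \<Rightarrow> (int \<Rightarrow> 'a \<times> 'b) set \<Rightarrow> bool" where
  "future_event l S \<longleftrightarrow> (\<forall>x y. (\<forall>m\<ge>l. fst (x m) = fst (y m)) \<longrightarrow> (\<forall>m>l. snd (x m) = snd (y m)) \<longrightarrow>
    x \<in> S \<longrightarrow> y \<in> S)"

text \<open>One step between neighbouring antidiagonals. Domain and codomain laws differ so that the
  step can be used with \<open>F\<close> and with its almost sure inverse.\<close>

locale half_step = dom: product_law \<mu> \<nu> + cod: product_law \<mu>' \<nu>'
  for \<mu> :: "'a measure" and \<nu> :: "'b measure" and \<mu>' :: "'c measure" and \<nu>' :: "'d measure" +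
  fixes F :: "'a \<times> 'b \<Rightarrow> 'c \<times> 'd"
  assumes F_meas [measurable]: "F \<in> \<mu> \<Otimes>\<^sub>M \<nu> \<rightarrow>\<^sub>M \<mu>' \<Otimes>\<^sub>M \<nu>'"
    and F_law: "distr (\<mu> \<Otimes>\<^sub>M \<nu>) (\<mu>' \<Otimes>\<^sub>M \<nu>') F = \<mu>' \<Otimes>\<^sub>M \<nu>'"
begin

lemma sitewise:
  "(\<lambda>e n. F (e n)) \<in> dom.law \<rightarrow>\<^sub>M cod.law" "distr dom.law cod.law (\<lambda>e n. F (e n)) = cod.law"
  by (rule distr_PiM_sitewise[OF _ _ F_meas F_law], unfold_locales)+

lemma bij_shift: "bij (\<lambda>k :: int. k + a)"
  by (rule bij_plus_right)

text \<open>Applying \<open>F\<close> cell by cell yields independent outputs whose two components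
  are again independent, so the carriers may be shifted against the sites.\<close>

lemma advance_meas [measurable]: "advance F \<in> dom.law \<rightarrow>\<^sub>M cod.law"
  and distr_advance: "distr dom.law cod.law (advance F) = cod.law"
proof -
  note R = cod.distr_law_reindex[OF bij_id bij_shift[of "- 1"]]
  have eq: "advance F = (\<lambda>c k. (fst (c (id k)), snd (c (k + - 1)))) \<circ> (\<lambda>e n. F (e n))"
    by (simp add: fun_eq_iff advance_def)
  show "advance F \<in> dom.law \<rightarrow>\<^sub>M cod.law"
    unfolding eq by (rule measurable_comp[OF sitewise(1) R(2)])
  show "distr dom.law cod.law (advance F) = cod.law"
    unfolding eq by (subst distr_distr[OF R(2) sitewise(1), symmetric]) (simp only: sitewise(2) R(1))
qed

lemma retreat_meas [measurable]: "retreat F \<in> dom.law \<rightarrow>\<^sub>M cod.law"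
  and distr_retreat: "distr dom.law cod.law (retreat F) = cod.law"
proof -
  note R = dom.distr_law_reindex[OF bij_id bij_shift[of 1]]
  have eq: "retreat F = (\<lambda>e n. F (e n)) \<circ> (\<lambda>c k. (fst (c (id k)), snd (c (k + 1))))"
    by (simp add: fun_eq_iff retreat_def)
  show "retreat F \<in> dom.law \<rightarrow>\<^sub>M cod.law"
    unfolding eq by (rule measurable_comp[OF R(2) sitewise(1)])
  show "distr dom.law cod.law (retreat F) = cod.law"
    unfolding eq by (subst distr_distr[OF sitewise(1) R(2), symmetric]) (simp only: sitewise(2) R(1))
qed

text \<open>A carrier at \<open>m\<close> on the new antidiagonal comes from the cell at
  \<open>m - 1\<close>. Hence \<open>C\<close>, with cutoff \<open>l + 1\<close>, looks through
  \<open>advance F\<close> only at cells beyond \<open>l\<close> and is independent of the site at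
  \<open>l\<close>. Joining the two gives a future event with cutoff \<open>l\<close>, ready for the
  next step back.\<close>

lemma emeasure_site_advance:
  assumes A: "A \<in> sets \<mu>" and C: "C \<in> sets cod.law" and fut: "future_event (l + 1) C"
  defines "D \<equiv> {x. fst (x l) \<in> A \<and> advance F x \<in> C}"
  shows "D \<in> sets dom.law" "emeasure dom.law D = emeasure \<mu> A * emeasure cod.law C"
    "future_event l D"
proof -
  have dep: "advance F y \<in> C" if "\<And>m. m > l \<Longrightarrow> x m = y m" "advance F x \<in> C" for x y
    using fut[unfolded future_event_def, rule_format, of "advance F x" "advance F y"] that
    by (simp add: advance_def)
  have SA: "(\<lambda>x. fst (x l)) -` A \<inter> space dom.law \<in> sets dom.law" 
    using A by measurable
  have SC: "advance F -` C \<inter> space dom.law \<in> sets dom.law"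
    by (rule measurable_sets[OF advance_meas C])
  have D: "D = ((\<lambda>x. fst (x l)) -` A \<inter> space dom.law) \<inter> (advance F -` C \<inter> space dom.law)"
    by (auto simp: D_def)
  show "D \<in> sets dom.law" unfolding D using SA SC by (rule sets.Int)
  have "emeasure dom.law D = emeasure dom.law ((\<lambda>x. fst (x l)) -` A \<inter> space dom.law)
      * emeasure dom.law (advance F -` C \<inter> space dom.law)"
    unfolding D
  proof (rule dom.emeasure_law_Int_split[OF SA SC, where I="{..l}" and K="{..l}"])
    show "dom.splice {..l} {..l} c d \<in> advance F -` C \<inter> space dom.law
        \<longleftrightarrow> d \<in> advance F -` C \<inter> space dom.law" for c d
      using dep[of "dom.splice {..l} {..l} c d" d] dep[of d "dom.splice {..l} {..l} c d"]
      by (auto simp: dom.splice_def)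
  qed (auto simp: dom.splice_def)
  also have "emeasure dom.law ((\<lambda>x. fst (x l)) -` A \<inter> space dom.law) = emeasure \<mu> A"
    using A by (subst emeasure_distr[symmetric, where N=\<mu>]) (simp_all add: dom.distr_law_fst)
  also have "emeasure dom.law (advance F -` C \<inter> space dom.law) = emeasure cod.law C"
    using C by (subst emeasure_distr[symmetric, OF advance_meas]) (simp_all only: distr_advance)
  finally show "emeasure dom.law D = emeasure \<mu> A * emeasure cod.law C" .
  show "future_event l D"
    unfolding future_event_def D_def
  proof (intro allI impI)
    fix x y assume 1: "\<forall>m\<ge>l. fst (x m) = fst (y m)" "\<forall>m>l. snd (x m) = snd (y m)"
      and 2: "x \<in> {x. fst (x l) \<in> A \<and> advance F x \<in> C}"
    have "x m = y m" if "m > l" for m using 1 that by (simp add: prod_eq_iff)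
    with 1 2 dep[of x y] show "y \<in> {x. fst (x l) \<in> A \<and> advance F x \<in> C}" by simp
  qed
qed

end

section \<open>Two-sided orbits of a measure-preserving map with an almost sure right
  inverse\<close>

definition orbit :: "('e \<Rightarrow> 'e) \<Rightarrow> ('e \<Rightarrow> 'e) \<Rightarrow> int \<Rightarrow> 'e \<Rightarrow> 'e" where
  "orbit S S' r w = (if r \<ge> 0 then (S ^^ nat r) w else (S' ^^ nat (- r)) w)"

lemma funpow_preserving:
  assumes S: "S \<in> N \<rightarrow>\<^sub>M N" and law: "distr N N S = N"
  shows "S ^^ k \<in> N \<rightarrow>\<^sub>M N" "distr N N (S ^^ k) = N"
proof (induction k)
  case 0
  { case 1 show ?case by (simp add: id_def) }
  { case 2 show ?case by (simp add: id_def) }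
next
  case (Suc k)
  { case 1 show ?case unfolding funpow.simps by (rule measurable_comp[OF Suc(1) S]) }
  { case 2 show ?case unfolding funpow.simps
      by (subst distr_distr[OF S Suc(1), symmetric]) (simp only: Suc(2) law) }
qed

lemma orbit_preserving:
  assumes S: "S \<in> N \<rightarrow>\<^sub>M N" "distr N N S = N" and S': "S' \<in> N \<rightarrow>\<^sub>M N" "distr N N S' = N"
  shows "orbit S S' r \<in> N \<rightarrow>\<^sub>M N" "distr N N (orbit S S' r) = N"
proof -
  have "orbit S S' r = (if r \<ge> 0 then S ^^ nat r else S' ^^ nat (- r))"
    by (simp add: fun_eq_iff orbit_def)
  then show "orbit S S' r \<in> N \<rightarrow>\<^sub>M N" "distr N N (orbit S S' r) = N"
    using funpow_preserving[OF S] funpow_preserving[OF S'] by auto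
qed

text \<open>For negative \<open>r\<close>, \<open>S\<close> has to cancel one application of
  \<open>S'\<close>. This holds almost surely at the orbit point, because that point again has law
  \<open>N\<close>; countably many \<open>r\<close> share one null set.\<close>

lemma AE_orbit_step:
  assumes S: "S \<in> N \<rightarrow>\<^sub>M N" "distr N N S = N" and S': "S' \<in> N \<rightarrow>\<^sub>M N" "distr N N S' = N"
    and inv: "AE w in N. S (S' w) = w"
  shows "AE w in N. \<forall>r. orbit S S' (r + 1) w = S (orbit S S' r w)"
proof -
  have "AE w in N. orbit S S' (r + 1) w = S (orbit S S' r w)" for r
  proof (cases "r \<ge> 0")
    case True
    then have "nat (r + 1) = Suc (nat r)" by simp
    with True show ?thesis by (simp add: orbit_def)
  next
    case False
    then have nat: "nat (- r) = Suc (nat (- r - 1))" by simp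
    have "AE w in N. S (S' (orbit S S' (r + 1) w)) = orbit S S' (r + 1) w"
      by (rule AE_distrD[OF orbit_preserving(1)[OF S S']])
         (unfold orbit_preserving(2)[OF S S'], rule inv)
    then show ?thesis
    proof eventually_elim
      case (elim w)
      have "orbit S S' r w = S' (orbit S S' (r + 1) w)"
      proof (cases "r = -1")
        case False
        with \<open>\<not> r \<ge> 0\<close> have "nat (- (r + 1)) = nat (- r - 1)" "\<not> r + 1 \<ge> 0" by auto
        with nat \<open>\<not> r \<ge> 0\<close> show ?thesis by (simp add: orbit_def)
      qed (simp add: orbit_def)
      with elim show ?case by simp
    qed
  qed
  then show ?thesis by (simp add: AE_all_countable)
qed

text \<open>Each lattice variable is an input of exactly one cell, so the inputs on all
  antidiagonals list the whole solution. The carrier \<open>us n t\<close> enters cell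
  \<open>(n + 1, t)\<close>, on antidiagonal \<open>n + t + 1\<close>; this explains the
  indices.\<close>

lemma sol2_diagonals:
  fixes e :: "int \<Rightarrow> int \<Rightarrow> 'x \<times> 'u" and w :: "int \<Rightarrow> int \<Rightarrow> 'xt \<times> 'ut"
  assumes w: "\<And>r. w r = advance F (e r)" and e: "\<And>r. e (r + 1) = advance (inv F) (w r)"
  shows "sol2 F (\<lambda>k. (fst (e k (2 * k)), fst (w k (2 * k + 1))))
    (\<lambda>n t. if even (n + t) then Inl (fst (e ((n + t) div 2) n)) else Inr (fst (w ((n + t) div 2) n)))
    (\<lambda>n t. if odd (n + t) then Inl (snd (e ((n + t + 1) div 2) (n + 1)))
      else Inr (snd (w ((n + t) div 2) (n + 1))))"
    (is "sol2 F ?c ?xs ?us")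
  unfolding sol2_def
proof (intro conjI allI)
  fix n t :: int
  have cells: "fst (w r n) = fst (F (e r n))" "snd (w r (n + 1)) = snd (F (e r n))"
    "fst (e (r + 1) n) = fst (inv F (w r n))" "snd (e (r + 1) (n + 1)) = snd (inv F (w r n))" for r
    unfolding e by (simp_all add: advance_def) (simp_all add: w advance_def)
  show "if even (n + t)
    then \<exists>a b. ?xs n t = Inl a \<and> ?us (n - 1) t = Inl b \<and>
      ?xs n (t + 1) = Inr (fst (F (a, b))) \<and> ?us n t = Inr (snd (F (a, b)))
    else \<exists>a b. ?xs n t = Inr a \<and> ?us (n - 1) t = Inr b \<and>
      ?xs n (t + 1) = Inl (fst (inv F (a, b))) \<and> ?us n t = Inl (snd (inv F (a, b)))"
  proof (cases "even (n + t)")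
    case True
    then obtain r where r: "n + t = 2 * r" by (rule evenE)
    then have r': "n + (t + 1) = 2 * r + 1" "n - 1 + t = 2 * r - 1" by simp_all
    show ?thesis
      unfolding r r' by (simp add: cells(1,2))
  next
    case False
    then obtain r where r: "n + t = 2 * r + 1" by (rule oddE)
    then have r': "n + (t + 1) = 2 * (r + 1)" "n - 1 + t = 2 * r" "2 * r + 1 + 1 = 2 * (r + 1)"
      by simp_all
    show ?thesis
      unfolding r r' by (simp add: cells(3,4))
  qed
next
  fix n :: int
  show "?xs n 0 = cfg2 ?c n"
    by (cases "even n") (auto simp: cfg2_def elim!: evenE oddE)
qed

context product_law
begin

text \<open>The second form mixes neighbouring indices in the way \<open>retreat\<close> does before
  applying the local map.\<close>

lemma AE_law_coordinates:
  assumes "AE z in \<mu> \<Otimes>\<^sub>M \<nu>. P z"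
  shows "AE c in law. \<forall>n. P (c n)" "AE c in law. \<forall>n. P (fst (c n), snd (c (n + 1)))"
proof -
  have *: "AE c in law. P (c n)" for n
    by (rule law.AE_component[OF _ assms]) simp
  then show "AE c in law. \<forall>n. P (c n)" by (simp add: AE_all_countable)
  note R = distr_law_reindex[OF bij_id bij_plus_right[of 1]]
  have "AE c in law. P (fst (c n), snd (c (n + 1)))" for n
    using AE_distrD[OF R(2), of "\<lambda>c. P (c n)", unfolded R(1), OF *] by simp
  then show "AE c in law. \<forall>n. P (fst (c n), snd (c (n + 1)))" by (simp add: AE_all_countable)
qed

end

section \<open>The stationary random field and the law of its rows\<close>

locale stationary_field = fwd: half_step \<mu> \<nu> \<mu>t \<nu>t F + bwd: half_step \<mu>t \<nu>t \<mu> \<nu> G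
  for \<mu> :: "'a measure" and \<nu> :: "'b measure" and \<mu>t :: "'c measure" and \<nu>t :: "'d measure"
    and F G +
  assumes FG: "AE w in \<mu>t \<Otimes>\<^sub>M \<nu>t. F (G w) = w" and GF: "AE z in \<mu> \<Otimes>\<^sub>M \<nu>. G (F z) = z"
begin

sublocale row: product_law \<mu> \<mu>t
  by unfold_locales (simp_all add: fwd.dom.space_mu fwd.cod.space_mu)

abbreviation N :: "(int \<Rightarrow> 'a \<times> 'b) measure" where "N \<equiv> fwd.dom.law"

text \<open>The cell inputs on the even antidiagonal \<open>2 * r\<close>, given those on
  antidiagonal 0; the odd antidiagonal \<open>2 * r + 1\<close> is
  \<open>advance F (diag r w)\<close>.\<close>

definition diag :: "int \<Rightarrow> (int \<Rightarrow> 'a \<times> 'b) \<Rightarrow> int \<Rightarrow> 'a \<times> 'b" where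
  "diag = orbit (advance G \<circ> advance F) (retreat G \<circ> retreat F)"

lemma two_steps:
  "advance G \<circ> advance F \<in> N \<rightarrow>\<^sub>M N" "distr N N (advance G \<circ> advance F) = N"
  "retreat G \<circ> retreat F \<in> N \<rightarrow>\<^sub>M N" "distr N N (retreat G \<circ> retreat F) = N"
proof -
  show "advance G \<circ> advance F \<in> N \<rightarrow>\<^sub>M N"
    by (rule measurable_comp[OF fwd.advance_meas bwd.advance_meas])
  show "retreat G \<circ> retreat F \<in> N \<rightarrow>\<^sub>M N"
    by (rule measurable_comp[OF fwd.retreat_meas bwd.retreat_meas])
  show "distr N N (advance G \<circ> advance F) = N"
    by (subst distr_distr[OF bwd.advance_meas fwd.advance_meas, symmetric])
       (simp only: fwd.distr_advance bwd.distr_advance)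
  show "distr N N (retreat G \<circ> retreat F) = N"
    by (subst distr_distr[OF bwd.retreat_meas fwd.retreat_meas, symmetric])
       (simp only: fwd.distr_retreat bwd.distr_retreat)
qed

lemma diag_meas [measurable]: "diag r \<in> N \<rightarrow>\<^sub>M N" and distr_diag: "distr N N (diag r) = N"
  unfolding diag_def by (rule orbit_preserving[OF two_steps])+

lemma AE_diag_step: "AE w in N. \<forall>r. diag (r + 1) w = advance G (advance F (diag r w))"
proof -
  have "AE w in N. (advance G \<circ> advance F) ((retreat G \<circ> retreat F) w) = w"
  proof -
    have "AE w in N. \<forall>n. G (F (fst (w n), snd (w (n + 1)))) = (fst (w n), snd (w (n + 1)))"
      by (rule fwd.dom.AE_law_coordinates(2)[OF GF])
    moreover have "AE w in N. \<forall>n. F (G (fst (retreat F w n), snd (retreat F w (n + 1))))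
        = (fst (retreat F w n), snd (retreat F w (n + 1)))"
      by (rule AE_distrD[OF fwd.retreat_meas])
         (unfold fwd.distr_retreat, rule fwd.cod.AE_law_coordinates(2)[OF FG])
    ultimately show ?thesis
    proof eventually_elim
      case (elim w)
      have "advance F (retreat G (retreat F w)) = retreat F w"
        using elim(2) by (simp add: fun_eq_iff advance_def retreat_def[of G])
          (metis diff_add_cancel prod.collapse snd_conv)
      moreover have "advance G (retreat F w) = w"
        using elim(1) by (simp add: fun_eq_iff advance_def retreat_def)
          (metis diff_add_cancel prod.collapse snd_conv)
      ultimately show ?case by simp
    qed
  qed
  from AE_orbit_step[OF two_steps this] show ?thesis
    unfolding diag_def by eventually_elim (metis comp_apply)
qed

text \<open>Site \<open>m\<close> at time \<open>t\<close> lies on antidiagonal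
  \<open>m + t\<close>. Pairs therefore begin at sites \<open>2 * j - t\<close>, which lie on even
  antidiagonals and carry values in the first space.\<close>

definition row_at :: "int \<Rightarrow> (int \<Rightarrow> 'a \<times> 'b) \<Rightarrow> int \<Rightarrow> 'a \<times> 'c" where
  "row_at t w j = (fst (diag j w (2 * j - t)), fst (advance F (diag j w) (2 * j + 1 - t)))"

lemma row_at_meas [measurable]: "row_at t \<in> N \<rightarrow>\<^sub>M row.law"
proof (rule row.measurable_into_lawI)
  show "(\<lambda>w. fst (row_at t w n)) \<in> N \<rightarrow>\<^sub>M \<mu>" for n
    unfolding row_at_def fst_conv
    by (rule measurable_compose[OF diag_meas]) measurable
  show "(\<lambda>w. snd (row_at t w n)) \<in> N \<rightarrow>\<^sub>M \<mu>t" for n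
    unfolding row_at_def snd_conv
    by (rule measurable_compose[OF measurable_compose[OF diag_meas fwd.advance_meas]]) measurable
qed

text \<open>The window is consumed from its right end: its last pair is absorbed into the event,
  which moves two antidiagonals back and remains a future event, while each site contributes one
  factor. Stationarity of \<open>diag\<close> settles the empty window.\<close>

lemma emeasure_row_window:
  assumes A: "\<And>j. A j \<in> sets \<mu>" and B: "\<And>j. B j \<in> sets \<mu>t"
    and S: "S \<in> sets N" "future_event (2 * (a + int k) - t) S"
  shows "emeasure N {w. (\<forall>j\<in>{a..<a + int k}. fst (row_at t w j) \<in> A j \<and> snd (row_at t w j) \<in> B j)
      \<and> diag (a + int k) w \<in> S}
    = (\<Prod>j\<in>{a..<a + int k}. emeasure \<mu> (A j)) * (\<Prod>j\<in>{a..<a + int k}. emeasure \<mu>t (B j)) * emeasure N S"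
  using S
proof (induction k arbitrary: S)
  case 0
  have "emeasure N S = emeasure N (diag a -` S \<inter> space N)"
    using 0 distr_diag[of a] by (metis emeasure_distr[OF diag_meas])
  then show ?case by (simp add: vimage_def)
next
  case (Suc k)
  let ?j = "a + int k"
  let ?l = "2 * ?j - t"
  \<comment> \<open>\<open>C\<close> absorbs the second site of pair \<open>?j\<close> on the odd
    antidiagonal, \<open>D\<close> the first one on the even antidiagonal before it.\<close>
  define C where "C = {x. fst (x (?l + 1)) \<in> B ?j \<and> advance G x \<in> S}"
  define D where "D = {x. fst (x ?l) \<in> A ?j \<and> advance F x \<in> C}"
  have "2 * (a + int (Suc k)) - t = ?l + 1 + 1" by simp
  with Suc.prems(2) have fut: "future_event (?l + 1 + 1) S" by (simp only:)
  note C = bwd.emeasure_site_advance[OF B[of ?j] Suc.prems(1) fut, folded C_def]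
  note D = fwd.emeasure_site_advance[OF A[of ?j] C(1,3), folded D_def]
  have window: "{w. (\<forall>j\<in>J. fst (row_at t w j) \<in> A j \<and> snd (row_at t w j) \<in> B j) \<and> diag r w \<in> S} \<in> sets N"
    if "finite J" "S \<in> sets N" for J r S
  proof -
    have "(row_at t -` {c. \<forall>j\<in>J. fst (c j) \<in> A j \<and> snd (c j) \<in> B j} \<inter> space N)
        \<inter> (diag r -` S \<inter> space N) \<in> sets N"
      using that A B by (intro sets.Int measurable_sets[OF row_at_meas] measurable_sets[OF diag_meas]
        row.sets_law_box) auto
    also have "(row_at t -` {c. \<forall>j\<in>J. fst (c j) \<in> A j \<and> snd (c j) \<in> B j} \<inter> space N)
        \<inter> (diag r -` S \<inter> space N)
      = {w. (\<forall>j\<in>J. fst (row_at t w j) \<in> A j \<and> snd (row_at t w j) \<in> B j) \<and> diag r w \<in> S}"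
      by auto
    finally show ?thesis .
  qed
  have range: "{a..<a + int (Suc k)} = insert ?j {a..<?j}" by auto
  have "emeasure N {w. (\<forall>j\<in>{a..<a + int (Suc k)}. fst (row_at t w j) \<in> A j \<and> snd (row_at t w j) \<in> B j)
      \<and> diag (a + int (Suc k)) w \<in> S}
    = emeasure N {w. (\<forall>j\<in>{a..<?j}. fst (row_at t w j) \<in> A j \<and> snd (row_at t w j) \<in> B j) \<and> diag ?j w \<in> D}"
  proof (rule emeasure_eq_AE)
    show "AE w in N. (w \<in> {w. (\<forall>j\<in>{a..<a + int (Suc k)}. fst (row_at t w j) \<in> A j \<and> snd (row_at t w j) \<in> B j)
        \<and> diag (a + int (Suc k)) w \<in> S})
      = (w \<in> {w. (\<forall>j\<in>{a..<?j}. fst (row_at t w j) \<in> A j \<and> snd (row_at t w j) \<in> B j) \<and> diag ?j w \<in> D})"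
      using AE_diag_step
    proof eventually_elim
      case (elim w)
      have "diag (a + int (Suc k)) w = advance G (advance F (diag ?j w))"
        using elim[rule_format, of ?j] by (simp add: algebra_simps)
      moreover have "2 * ?j + 1 - t = ?l + 1" by simp
      then have "fst (row_at t w ?j) = fst (diag ?j w ?l)"
        "snd (row_at t w ?j) = fst (advance F (diag ?j w) (?l + 1))"
        by (simp_all only: row_at_def fst_conv snd_conv)
      ultimately show ?case
        unfolding range C_def D_def by (simp only: mem_Collect_eq Set.ball_simps) blast
    qed
  qed (use Suc.prems D(1) in \<open>auto intro!: window\<close>)
  also have "\<dots> = (\<Prod>j\<in>{a..<?j}. emeasure \<mu> (A j)) * (\<Prod>j\<in>{a..<?j}. emeasure \<mu>t (B j)) * emeasure N D"
    by (rule Suc.IH[OF D(1,3)])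
  also have "\<dots> = (\<Prod>j\<in>{a..<a + int (Suc k)}. emeasure \<mu> (A j))
      * (\<Prod>j\<in>{a..<a + int (Suc k)}. emeasure \<mu>t (B j)) * emeasure N S"
    unfolding range D(2) C(2) by (simp add: mult_ac)
  finally show ?case .
qed

lemma distr_row_at: "distr N row.law (row_at t) = row.law"
proof (rule row.eq_lawI)
  fix J :: "int set" and A :: "int \<Rightarrow> 'a set" and B :: "int \<Rightarrow> 'c set"
  assume J: "finite J" and A: "\<And>j. A j \<in> sets \<mu>" and B: "\<And>j. B j \<in> sets \<mu>t"
  have UNIV_in: "UNIV \<in> sets \<mu>" "UNIV \<in> sets \<mu>t"
    using sets.top[of \<mu>] sets.top[of \<mu>t] by (simp_all add: row.space_mu row.space_nu)
  have one: "emeasure \<mu> UNIV = 1" "emeasure \<mu>t UNIV = 1"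
    using prob_space.emeasure_space_1[OF row.prob_mu] prob_space.emeasure_space_1[OF row.prob_nu] by (simp_all add: row.space_mu row.space_nu)
  \<comment> \<open>Any bound for the indices in \<open>J\<close> would do: it places
    \<open>J\<close> in an interval, whose other indices contribute factors 1.\<close>
  define b where "b = (\<Sum>j\<in>J. \<bar>j\<bar>)"
  have "\<bar>j\<bar> \<le> b" if "j \<in> J" for j
    unfolding b_def using J that by (intro member_le_sum) auto
  then have sub: "J \<subseteq> {- b..<- b + int (nat (2 * b + 1))}" by force
  define W where "W = {- b..<- b + int (nat (2 * b + 1))}"
  have JW: "J \<subseteq> W" "finite W" using sub by (simp_all add: W_def)
  let ?A = "\<lambda>j. if j \<in> J then A j else UNIV" and ?B = "\<lambda>j. if j \<in> J then B j else UNIV"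
  have "emeasure (distr N row.law (row_at t)) {c. \<forall>j\<in>J. fst (c j) \<in> A j \<and> snd (c j) \<in> B j}
      = emeasure N {w. (\<forall>j\<in>W. fst (row_at t w j) \<in> ?A j \<and> snd (row_at t w j) \<in> ?B j)
        \<and> diag (- b + int (nat (2 * b + 1))) w \<in> UNIV}"
    using JW row.sets_law_box[OF J A B]
    by (subst emeasure_distr[OF row_at_meas]) (auto intro!: arg_cong[where f="emeasure N"] split: if_splits)
  also have "\<dots> = (\<Prod>j\<in>W. emeasure \<mu> (?A j)) * (\<Prod>j\<in>W. emeasure \<mu>t (?B j)) * emeasure N UNIV"
    unfolding W_def
    using A B UNIV_in sets.top[of N]
    by (intro emeasure_row_window) (auto simp: future_event_def)
  also have "emeasure N UNIV = 1"
    using fwd.dom.law.P.emeasure_space_1 by simp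
  also have "(\<Prod>j\<in>W. emeasure \<mu> (?A j)) = (\<Prod>j\<in>J. emeasure \<mu> (A j))"
    using JW by (intro prod.mono_neutral_cong_right) (auto simp: one)
  also have "(\<Prod>j\<in>W. emeasure \<mu>t (?B j)) = (\<Prod>j\<in>J. emeasure \<mu>t (B j))"
    using JW by (intro prod.mono_neutral_cong_right) (auto simp: one)
  finally show "emeasure (distr N row.law (row_at t)) {c. \<forall>j\<in>J. fst (c j) \<in> A j \<and> snd (c j) \<in> B j}
      = (\<Prod>j\<in>J. emeasure \<mu> (A j)) * (\<Prod>j\<in>J. emeasure \<mu>t (B j))" by simp
qed simp

end

section \<open>Type II model: from the local balance to invariance\<close>

context type2_model
begin

context
  fixes \<nu> :: "'v measure" and \<nu>t :: "'vt measure"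
  assumes prob_nu': "prob_space \<nu>" and sets_nu' [measurable_cong]: "sets \<nu> = sets borel"
    and prob_nut': "prob_space \<nu>t" and sets_nut' [measurable_cong]: "sets \<nu>t = sets borel"
    and balance: "distr (\<mu> \<Otimes>\<^sub>M \<nu>) (\<mu>t \<Otimes>\<^sub>M \<nu>t) F = \<mu>t \<Otimes>\<^sub>M \<nu>t"
begin

lemma stationary_fieldE:
  obtains G where "stationary_field \<mu> \<nu> \<mu>t \<nu>t F G"
proof -
  have sp: "space \<nu> = UNIV" "space \<nu>t = UNIV"
    using sets_eq_imp_space_eq[OF sets_nu'] sets_eq_imp_space_eq[OF sets_nut'] by simp_all
  interpret d: product_law \<mu> \<nu>
    by (intro product_law.intro prob_mu prob_nu' space_mu sp)
  interpret c: product_law \<mu>t \<nu>t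
    by (intro product_law.intro prob_nu prob_nut' space_nu sp)
  have sets_d: "sets (\<mu> \<Otimes>\<^sub>M \<nu>) = sets borel"
    using sets_pair_measure_cong[OF sets_mu sets_nu'] unfolding borel_prod .
  have sets_c: "sets (\<mu>t \<Otimes>\<^sub>M \<nu>t) = sets borel"
    using sets_pair_measure_cong[OF sets_mut sets_nut'] unfolding borel_prod .
  have F_meas: "F \<in> \<mu> \<Otimes>\<^sub>M \<nu> \<rightarrow>\<^sub>M \<mu>t \<Otimes>\<^sub>M \<nu>t"
    by (rule F_measurable[OF sets_nu' sets_nut'])
  obtain G where G: "G \<in> borel \<rightarrow>\<^sub>M borel" and FG': "AE w in distr (\<mu> \<Otimes>\<^sub>M \<nu>) borel F. F (G w) = w"
    using borel_inverse_AE[OF F_borel bij_is_inj[OF bij_F] d.munu.prob_space_axioms sets_d] .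
  have "distr (\<mu> \<Otimes>\<^sub>M \<nu>) borel F = distr (\<mu> \<Otimes>\<^sub>M \<nu>) (\<mu>t \<Otimes>\<^sub>M \<nu>t) F"
    by (rule distr_cong) (simp_all only: sets_c)
  with FG' have FG: "AE w in \<mu>t \<Otimes>\<^sub>M \<nu>t. F (G w) = w" by (simp only: balance)
  \<comment> \<open>By the balance \<open>F z\<close> has the law under which \<open>G\<close> is a
    right inverse; injectivity of \<open>F\<close> then makes it a left inverse.\<close>
  have "AE z in \<mu> \<Otimes>\<^sub>M \<nu>. F (G (F z)) = F z"
    by (rule AE_distrD[OF F_meas]) (unfold balance, rule FG)
  then have GF: "AE z in \<mu> \<Otimes>\<^sub>M \<nu>. G (F z) = z"
    by eventually_elim (use bij_is_inj[OF bij_F] in \<open>auto dest: injD\<close>)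
  have G_meas: "G \<in> \<mu>t \<Otimes>\<^sub>M \<nu>t \<rightarrow>\<^sub>M \<mu> \<Otimes>\<^sub>M \<nu>"
    using G measurable_cong_sets[OF sets_c sets_d] by simp
  have "distr (\<mu>t \<Otimes>\<^sub>M \<nu>t) (\<mu> \<Otimes>\<^sub>M \<nu>) G
      = distr (distr (\<mu> \<Otimes>\<^sub>M \<nu>) (\<mu>t \<Otimes>\<^sub>M \<nu>t) F) (\<mu> \<Otimes>\<^sub>M \<nu>) G"
    by (simp only: balance)
  also have "\<dots> = distr (\<mu> \<Otimes>\<^sub>M \<nu>) (\<mu> \<Otimes>\<^sub>M \<nu>) (G \<circ> F)"
    by (rule distr_distr[OF G_meas F_meas])
  also have "\<dots> = distr (\<mu> \<Otimes>\<^sub>M \<nu>) (\<mu> \<Otimes>\<^sub>M \<nu>) (\<lambda>z. z)"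
    by (rule distr_cong_AE[OF refl refl _ measurable_comp[OF F_meas G_meas]]) (use GF in simp_all)
  finally have G_law: "distr (\<mu>t \<Otimes>\<^sub>M \<nu>t) (\<mu> \<Otimes>\<^sub>M \<nu>) G = \<mu> \<Otimes>\<^sub>M \<nu>"
    by simp
  have "stationary_field \<mu> \<nu> \<mu>t \<nu>t F G"
    by (intro stationary_field.intro half_step.intro half_step_axioms.intro
        stationary_field_axioms.intro d.product_law_axioms c.product_law_axioms
        F_meas balance G_meas G_law FG GF)
  then show thesis by (rule that)
qed

text \<open>Row 0 of the field lies almost surely in \<open>Xstar2 F\<close>, so the field is the
  solution started from it. The image row and the carriers thus become marginals of the field, whose
  laws are known.\<close>

lemma balance_imp_invariant: "distr law law (T2 F) = law"
  and distr_Uodd2: "distr law \<nu> (Uodd2 F n) = \<nu>"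
  and distr_Ueven2: "distr law \<nu>t (Ueven2 F n) = \<nu>t"
proof -
  obtain G where "stationary_field \<mu> \<nu> \<mu>t \<nu>t F G" by (rule stationary_fieldE)
  then interpret fld: stationary_field \<mu> \<nu> \<mu>t \<nu>t F G .
  have star_row: "AE w in fld.N. fld.row_at 0 w \<in> Xstar2 F"
    by (rule AE_distrD[OF fld.row_at_meas]) (unfold fld.distr_row_at, rule AE_star)
  \<comment> \<open>The field runs on \<open>G\<close> whereas \<open>sol2\<close> speaks of
    \<open>inv F\<close>; on this event they agree on all odd antidiagonals at once.\<close>
  have inverse: "AE w in fld.N. \<forall>r n. F (G (advance F (fld.diag r w) n)) = advance F (fld.diag r w) n"
  proof -
    have "AE w in fld.N. \<forall>n. F (G (advance F (fld.diag r w) n)) = advance F (fld.diag r w) n" for r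
    proof -
      have "AE e in fld.N. \<forall>n. F (G (advance F e n)) = advance F e n"
        by (rule AE_distrD[OF fld.fwd.advance_meas])
           (unfold fld.fwd.distr_advance, rule fld.fwd.cod.AE_law_coordinates(1)[OF fld.FG])
      then show ?thesis
        by (intro AE_distrD[OF fld.diag_meas]) (unfold fld.distr_diag)
    qed
    then show ?thesis by (subst AE_all_countable) auto
  qed
  have main: "AE w in fld.N. T2 F (fld.row_at 0 w) = (\<lambda>k. fld.row_at 1 w (k + 1))
      \<and> (\<forall>n. Uodd2 F n (fld.row_at 0 w) = snd (fld.diag n w (2 * n)))
      \<and> (\<forall>n. Ueven2 F n (fld.row_at 0 w) = snd (advance F (fld.diag n w) (2 * n + 1)))"
    using star_row inverse fld.AE_diag_step
  proof eventually_elim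
    case (elim w)
    define e where "e r = fld.diag r w" for r
    define y where "y r = advance F (e r)" for r
    have "G (y r n) = inv F (y r n)" for r n
      using elim(2)[rule_format, of r n] bij_is_inj[OF bij_F] by (metis e_def y_def inv_f_f)
    then have "advance G (y r) = advance (inv F) (y r)" for r
      by (simp add: fun_eq_iff advance_def)
    then have step: "e (r + 1) = advance (inv F) (y r)" for r
      using elim(3) by (simp add: e_def y_def)
    have row0: "fld.row_at 0 w = (\<lambda>k. (fst (e k (2 * k)), fst (y k (2 * k + 1))))"
      by (simp add: fun_eq_iff fld.row_at_def e_def y_def)
    have "sol2 F (fld.row_at 0 w)
      (\<lambda>n t. if even (n + t) then Inl (fst (e ((n + t) div 2) n)) else Inr (fst (y ((n + t) div 2) n)))
      (\<lambda>n t. if odd (n + t) then Inl (snd (e ((n + t + 1) div 2) (n + 1)))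
        else Inr (snd (y ((n + t) div 2) (n + 1))))"
      unfolding row0 by (rule sol2_diagonals[where w=y and e=e and F=F, OF y_def step])
    note sol = solof2_eqI[OF elim(1) this]
    show ?case
    proof (intro conjI allI)
      \<comment> \<open>Pair \<open>k\<close> of the new row consists of the sites
        \<open>2 * k + 1\<close> and \<open>2 * k + 2\<close> at time 1, which is pair
        \<open>k + 1\<close> of \<open>row_at 1\<close>.\<close>
      have "(2 * k + 1 + 1) div 2 = k + 1" "(2 * k + 2 + 1) div 2 = k + 1" for k :: int by simp_all
      moreover have "2 * (k + 1) - 1 = 2 * k + 1" "2 * (k + 1) + 1 - 1 = 2 * k + 2" for k :: int
        by simp_all
      ultimately show "T2 F (fld.row_at 0 w) = (\<lambda>k. fld.row_at 1 w (k + 1))"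
        using elim(1) by (simp only: fun_eq_iff T2_def sol fld.row_at_def if_True) (simp add: e_def y_def add.commute)
      show "Uodd2 F n (fld.row_at 0 w) = snd (fld.diag n w (2 * n))" for n
        using elim(1) by (simp add: Uodd2_def U2_def sol e_def)
      show "Ueven2 F n (fld.row_at 0 w) = snd (advance F (fld.diag n w) (2 * n + 1))" for n
        using elim(1) by (simp add: Ueven2_def U2_def sol e_def y_def)
    qed
  qed
  note shift = distr_law_reindex[OF bij_plus_right[of 1] bij_plus_right[of 1]]
  have "distr law law (T2 F) = distr (distr fld.N law (fld.row_at 0)) law (T2 F)"
    by (simp only: fld.distr_row_at)
  also have "\<dots> = distr fld.N law (T2 F \<circ> fld.row_at 0)"
    by (rule distr_distr[OF T2_meas fld.row_at_meas])
  also have "\<dots> = distr fld.N law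
      ((\<lambda>c k. (fst (c (k + 1)), snd (c (k + 1)))) \<circ> fld.row_at 1)"
  proof (rule distr_cong_AE[OF refl refl])
    show "AE w in fld.N. (T2 F \<circ> fld.row_at 0) w
        = ((\<lambda>c k. (fst (c (k + 1)), snd (c (k + 1)))) \<circ> fld.row_at 1) w"
      using main by eventually_elim simp
  qed (rule measurable_comp[OF fld.row_at_meas T2_meas] measurable_comp[OF fld.row_at_meas shift(2)])+
  also have "\<dots> = law"
    by (subst distr_distr[OF shift(2) fld.row_at_meas, symmetric]) (simp only: fld.distr_row_at shift(1))
  finally show "distr law law (T2 F) = law" .

  have Uo: "Uodd2 F n \<in> law \<rightarrow>\<^sub>M \<nu>" and Ue: "Ueven2 F n \<in> law \<rightarrow>\<^sub>M \<nu>t" by measurable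
  have coord: "(\<lambda>e. snd (e (2 * n))) \<in> fld.N \<rightarrow>\<^sub>M \<nu>"
    "(\<lambda>e. snd (e (2 * n + 1))) \<in> fld.fwd.cod.law \<rightarrow>\<^sub>M \<nu>t" by measurable
  have "distr law \<nu> (Uodd2 F n) = distr (distr fld.N law (fld.row_at 0)) \<nu> (Uodd2 F n)"
    by (simp only: fld.distr_row_at)
  also have "\<dots> = distr fld.N \<nu> (Uodd2 F n \<circ> fld.row_at 0)"
    by (rule distr_distr[OF Uo fld.row_at_meas])
  also have "\<dots> = distr fld.N \<nu> ((\<lambda>e. snd (e (2 * n))) \<circ> fld.diag n)"
  proof (rule distr_cong_AE[OF refl refl])
    show "AE w in fld.N. (Uodd2 F n \<circ> fld.row_at 0) w = ((\<lambda>e. snd (e (2 * n))) \<circ> fld.diag n) w"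
      using main by eventually_elim simp
  qed (rule measurable_comp[OF fld.row_at_meas Uo] measurable_comp[OF fld.diag_meas coord(1)])+
  also have "\<dots> = \<nu>"
    by (subst distr_distr[OF coord(1) fld.diag_meas, symmetric])
       (simp only: fld.distr_diag fld.fwd.dom.distr_law_snd)
  finally show "distr law \<nu> (Uodd2 F n) = \<nu>" .

  have adv: "advance F \<circ> fld.diag n \<in> fld.N \<rightarrow>\<^sub>M fld.fwd.cod.law"
    by (rule measurable_comp[OF fld.diag_meas fld.fwd.advance_meas])
  have "distr law \<nu>t (Ueven2 F n) = distr (distr fld.N law (fld.row_at 0)) \<nu>t (Ueven2 F n)"
    by (simp only: fld.distr_row_at)
  also have "\<dots> = distr fld.N \<nu>t (Ueven2 F n \<circ> fld.row_at 0)"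
    by (rule distr_distr[OF Ue fld.row_at_meas])
  also have "\<dots> = distr fld.N \<nu>t ((\<lambda>e. snd (e (2 * n + 1))) \<circ> (advance F \<circ> fld.diag n))"
  proof (rule distr_cong_AE[OF refl refl])
    show "AE w in fld.N. (Ueven2 F n \<circ> fld.row_at 0) w
        = ((\<lambda>e. snd (e (2 * n + 1))) \<circ> (advance F \<circ> fld.diag n)) w"
      using main by eventually_elim simp
  qed (rule measurable_comp[OF fld.row_at_meas Ue] measurable_comp[OF adv coord(2)])+
  also have "\<dots> = \<nu>t"
    by (subst distr_distr[OF coord(2) adv, symmetric],
        subst distr_distr[OF fld.fwd.advance_meas fld.diag_meas, symmetric])
       (simp only: fld.distr_diag fld.fwd.distr_advance fld.fwd.cod.distr_law_snd)
  finally show "distr law \<nu>t (Ueven2 F n) = \<nu>t" .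
qed

end

end

section \<open>Type I models as type II models\<close>

definition pair_sites :: "(int \<Rightarrow> 'x) \<Rightarrow> int \<Rightarrow> 'x \<times> 'x" where
  "pair_sites x k = (x (2 * k), x (2 * k + 1))"

definition unpair_sites :: "(int \<Rightarrow> 'x \<times> 'x) \<Rightarrow> int \<Rightarrow> 'x" where
  "unpair_sites c n = (if even n then fst (c (n div 2)) else snd (c (n div 2)))"

lemma unpair_pair_sites [simp]: "unpair_sites (pair_sites x) = x"
  by (auto simp: fun_eq_iff unpair_sites_def pair_sites_def)

lemma pair_unpair_sites [simp]: "pair_sites (unpair_sites c) = c"
  by (simp add: fun_eq_iff unpair_sites_def pair_sites_def)

lemma cfg2_pair_sites: "cfg2 (pair_sites x) n = (if even n then Inl (x n) else Inr (x n))"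
  by (auto simp: cfg2_def pair_sites_def)

definition tag_x :: "(int \<Rightarrow> int \<Rightarrow> 'x) \<Rightarrow> int \<Rightarrow> int \<Rightarrow> 'x + 'x" where
  "tag_x xs n t = (if even (n + t) then Inl (xs n t) else Inr (xs n t))"

definition tag_u :: "(int \<Rightarrow> int \<Rightarrow> 'u) \<Rightarrow> int \<Rightarrow> int \<Rightarrow> 'u + 'u" where
  "tag_u us n t = (if odd (n + t) then Inl (us n t) else Inr (us n t))"

definition untag :: "(int \<Rightarrow> int \<Rightarrow> 'x + 'x) \<Rightarrow> int \<Rightarrow> int \<Rightarrow> 'x" where
  "untag xs n t = (case xs n t of Inl a \<Rightarrow> a | Inr a \<Rightarrow> a)"

lemma untag_tag [simp]: "untag (tag_x xs) = xs" "untag (tag_u us) = us"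
  by (simp_all add: fun_eq_iff untag_def tag_x_def tag_u_def)

lemma tag_untag:
  assumes "checkered xs us"
  shows "tag_x (untag xs) = xs" "tag_u (untag us) = us"
proof -
  have "tag_x (untag xs) n t = xs n t" for n t
  proof -
    have "isl (xs n t) = even (n + t)" using assms by (simp only: checkered_def)
    then show ?thesis by (cases "xs n t") (simp_all add: untag_def tag_x_def)
  qed
  moreover have "tag_u (untag us) n t = us n t" for n t
  proof -
    have "isl (us n t) = odd (n + t)" using assms by (simp only: checkered_def)
    then show ?thesis by (cases "us n t") (simp_all add: untag_def tag_u_def)
  qed
  ultimately show "tag_x (untag xs) = xs" "tag_u (untag us) = us" by (simp_all add: fun_eq_iff)
qed

locale involution =
  fixes F :: "'x \<times> 'u \<Rightarrow> 'x \<times> 'u"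
  assumes inv_inv: "F (F z) = z"
begin

lemma inv_eq: "inv F = F"
  using inv_inv by (intro inv_equality) auto

lemma bij: "bij F"
  using inv_inv by (rule involuntory_imp_bij)

lemma sol2_tag:
  assumes "sol1 F x xs us"
  shows "sol2 F (pair_sites x) (tag_x xs) (tag_u us)"
  unfolding sol2_def
proof (intro conjI allI)
  fix n t
  have "F (xs n t, us (n - 1) t) = (xs n (t + 1), us n t)"
    using assms unfolding sol1_def by blast
  then show "if even (n + t) then
        (\<exists>a b. tag_x xs n t = Inl a \<and> tag_u us (n - 1) t = Inl b \<and>
               tag_x xs n (t + 1) = Inr (fst (F (a, b))) \<and> tag_u us n t = Inr (snd (F (a, b))))
      else
        (\<exists>a b. tag_x xs n t = Inr a \<and> tag_u us (n - 1) t = Inr b \<and>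
               tag_x xs n (t + 1) = Inl (fst (inv F (a, b))) \<and> tag_u us n t = Inl (snd (inv F (a, b))))"
    unfolding inv_eq by (simp add: tag_x_def tag_u_def)
next
  show "tag_x xs n 0 = cfg2 (pair_sites x) n" for n
    using assms by (simp add: cfg2_pair_sites tag_x_def sol1_def)
qed

lemma sol1_untag:
  assumes "sol2 F (pair_sites x) xs us"
  shows "sol1 F x (untag xs) (untag us)"
  unfolding sol1_def
proof (intro conjI allI)
  fix n t
  have "if even (n + t) then
        (\<exists>a b. xs n t = Inl a \<and> us (n - 1) t = Inl b \<and>
               xs n (t + 1) = Inr (fst (F (a, b))) \<and> us n t = Inr (snd (F (a, b))))
      else
        (\<exists>a b. xs n t = Inr a \<and> us (n - 1) t = Inr b \<and>
               xs n (t + 1) = Inl (fst (F (a, b))) \<and> us n t = Inl (snd (F (a, b))))"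
    using assms unfolding sol2_def inv_eq by blast
  then show "F (untag xs n t, untag us (n - 1) t) = (untag xs n (t + 1), untag us n t)"
    by (auto simp: untag_def split: if_splits)
next
  show "untag xs n 0 = x n" for n
    using assms by (simp add: cfg2_pair_sites untag_def sol2_def)
qed

text \<open>Tagging is a bijection between the solutions for \<open>x\<close> and those for
  \<open>pair_sites x\<close>, whose tags are forced by \<open>sol2\<close>; existence and
  uniqueness pass through it.\<close>

lemma pair_sites_star: "pair_sites x \<in> Xstar2 F \<longleftrightarrow> x \<in> Xstar1 F"
proof
  assume "x \<in> Xstar1 F"
  then obtain p where p: "sol1 F x (fst p) (snd p)" "\<And>q. sol1 F x (fst q) (snd q) \<Longrightarrow> q = p"
    unfolding Xstar1_def by blast
  have "\<exists>!q. sol2 F (pair_sites x) (fst q) (snd q)"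
  proof (rule ex1I)
    show "sol2 F (pair_sites x) (fst (tag_x (fst p), tag_u (snd p))) (snd (tag_x (fst p), tag_u (snd p)))"
      using sol2_tag[OF p(1)] by simp
    fix q assume q: "sol2 F (pair_sites x) (fst q) (snd q)"
    have "(untag (fst q), untag (snd q)) = p"
      using p(2) sol1_untag[OF q] by simp
    moreover have "checkered (fst q) (snd q)" using q by (simp add: sol2_iff)
    ultimately show "q = (tag_x (fst p), tag_u (snd p))"
      using tag_untag[of "fst q" "snd q"] by (auto simp: prod_eq_iff)
  qed
  then show "pair_sites x \<in> Xstar2 F" by (simp add: Xstar2_def)
next
  assume "pair_sites x \<in> Xstar2 F"
  then obtain q where q: "sol2 F (pair_sites x) (fst q) (snd q)"
    "\<And>p. sol2 F (pair_sites x) (fst p) (snd p) \<Longrightarrow> p = q"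
    unfolding Xstar2_def by blast
  have "\<exists>!p. sol1 F x (fst p) (snd p)"
  proof (rule ex1I)
    show "sol1 F x (fst (untag (fst q), untag (snd q))) (snd (untag (fst q), untag (snd q)))"
      using sol1_untag[OF q(1)] by simp
    fix p assume "sol1 F x (fst p) (snd p)"
    then have "(tag_x (fst p), tag_u (snd p)) = q"
      using q(2) sol2_tag by simp
    then show "p = (untag (fst q), untag (snd q))" by auto
  qed
  then show "x \<in> Xstar1 F" by (simp add: Xstar1_def)
qed

text \<open>Type II dynamics shifts by one site to keep each space at its parity. For type I this
  appears as a translation, which preserves a product of equal laws.\<close>

lemma pair_sites_dynamics:
  assumes x: "x \<in> Xstar1 F"
  shows "T2 F (pair_sites x) = pair_sites (\<lambda>n. T1 F x (n + 1))"
    and "Uodd2 F n (pair_sites x) = U1 F (2 * n - 1) x"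
    and "Ueven2 F n (pair_sites x) = U1 F (2 * n) x"
proof -
  have star: "pair_sites x \<in> Xstar2 F" using x by (simp add: pair_sites_star)
  obtain xs us where p: "solof1 F x = (xs, us)" by force
  then have "solof2 F (pair_sites x) = (tag_x xs, tag_u us)"
    using solof2_eqI[OF star sol2_tag] sol1_solof1[OF x] by simp
  then show "T2 F (pair_sites x) = pair_sites (\<lambda>n. T1 F x (n + 1))"
    "Uodd2 F n (pair_sites x) = U1 F (2 * n - 1) x" "Ueven2 F n (pair_sites x) = U1 F (2 * n) x"
    using x star p
    by (simp_all add: fun_eq_iff T2_def T1_def pair_sites_def U1_def Uodd2_def Ueven2_def U2_def
        tag_x_def tag_u_def add.assoc)
qed

end

lemma U1_shift:
  assumes x: "x \<in> Xstar1 F" and y: "(\<lambda>n. x (n + 1)) \<in> Xstar1 F"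
  shows "U1 F (n + 1) x = U1 F n (\<lambda>n. x (n + 1))"
proof -
  obtain xs us where p: "solof1 F x = (xs, us)" by force
  then have s: "sol1 F x xs us" using sol1_solof1[OF x] by simp
  have "F (xs (n + 1) t, us (n - 1 + 1) t) = (xs (n + 1) (t + 1), us (n + 1) t)" for n t
    using s[unfolded sol1_def, THEN conjunct1, rule_format, of "n + 1" t] by simp
  then have "sol1 F (\<lambda>n. x (n + 1)) (\<lambda>n. xs (n + 1)) (\<lambda>n. us (n + 1))"
    using s unfolding sol1_def by simp
  from solof1_eqI[OF y this] show ?thesis
    using x y p by (simp add: U1_def)
qed

section \<open>Transfer of laws between a type I row and its paired encoding\<close>

locale type1_model = involution F
  for F :: "'x::polish_space \<times> 'u::polish_space \<Rightarrow> 'x \<times> 'u" +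
  fixes \<mu> :: "'x measure"
  assumes F_borel: "F \<in> borel \<rightarrow>\<^sub>M borel"
    and prob_mu1: "prob_space \<mu>" and sets_mu1: "sets \<mu> = sets borel"
    and star1: "emeasure (\<Pi>\<^sub>M n\<in>(UNIV :: int set). \<mu>) (Xstar1 F) = 1"
    and T1_meas: "T1 F \<in> (\<Pi>\<^sub>M n\<in>UNIV. \<mu>) \<rightarrow>\<^sub>M (\<Pi>\<^sub>M n\<in>UNIV. \<mu>)"
    and U1_meas: "\<And>n. U1 F n \<in> (\<Pi>\<^sub>M n\<in>UNIV. \<mu>) \<rightarrow>\<^sub>M borel"
begin

abbreviation M :: "(int \<Rightarrow> 'x) measure" where "M \<equiv> \<Pi>\<^sub>M n\<in>UNIV. \<mu>"

lemma space_mu1: "space \<mu> = UNIV"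
  using sets_eq_imp_space_eq[OF sets_mu1] by simp

sublocale pairs: product_law \<mu> \<mu>
  by (intro product_law.intro prob_mu1 space_mu1)

sublocale M: product_prob_space "\<lambda>_. \<mu>" "UNIV :: int set"
  by unfold_locales

lemma space_M [simp]: "space M = UNIV"
  by (auto simp: space_PiM space_mu1)

lemma coordinate_meas [measurable]: "(\<lambda>x. x n) \<in> M \<rightarrow>\<^sub>M \<mu>"
  by (rule measurable_component_singleton) simp

lemma into_M_measI:
  assumes "\<And>n. (\<lambda>w. Z w n) \<in> S \<rightarrow>\<^sub>M \<mu>"
  shows "Z \<in> S \<rightarrow>\<^sub>M M"
proof -
  have "(\<lambda>w. \<lambda>n\<in>UNIV. Z w n) \<in> S \<rightarrow>\<^sub>M M" using assms by (intro measurable_restrict)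
  then show ?thesis by (simp only: restrict_UNIV)
qed

lemma pair_sites_meas [measurable]: "pair_sites \<in> M \<rightarrow>\<^sub>M pairs.law"
  by (rule pairs.measurable_into_lawI) (simp_all add: pair_sites_def)

lemma unpair_sites_meas [measurable]: "unpair_sites \<in> pairs.law \<rightarrow>\<^sub>M M"
proof (rule into_M_measI)
  show "(\<lambda>c. unpair_sites c n) \<in> pairs.law \<rightarrow>\<^sub>M \<mu>" for n
    unfolding unpair_sites_def by (cases "even n") simp_all
qed

lemma distr_pair_sites: "distr M pairs.law pair_sites = pairs.law"
proof (rule pairs.eq_lawI)
  fix J :: "int set" and A B :: "int \<Rightarrow> 'x set"
  assume J: "finite J" and A: "\<And>j. A j \<in> sets \<mu>" and B: "\<And>j. B j \<in> sets \<mu>"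
  let ?E = "(\<lambda>j. 2 * j) ` J" and ?O = "(\<lambda>j. 2 * j + 1) ` J"
  let ?C = "\<lambda>i. if even i then A (i div 2) else B (i div 2)"
  have "emeasure (distr M pairs.law pair_sites) {c. \<forall>j\<in>J. fst (c j) \<in> A j \<and> snd (c j) \<in> B j}
      = emeasure M {x \<in> space M. \<forall>i\<in>?E \<union> ?O. x i \<in> ?C i}"
    using pairs.sets_law_box[OF J A B]
    by (subst emeasure_distr[OF pair_sites_meas])
       (auto intro!: arg_cong[where f="emeasure M"] simp: pair_sites_def ball_Un)
  also have "\<dots> = (\<Prod>i\<in>?E \<union> ?O. emeasure \<mu> (?C i))"
    using J A B by (intro M.emeasure_PiM_Collect) auto
  also have "\<dots> = (\<Prod>i\<in>?E. emeasure \<mu> (?C i)) * (\<Prod>i\<in>?O. emeasure \<mu> (?C i))"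
    using J by (intro prod.union_disjoint) (auto, presburger)
  also have "(\<Prod>i\<in>?E. emeasure \<mu> (?C i)) = (\<Prod>j\<in>J. emeasure \<mu> (A j))"
    by (subst prod.reindex) (auto simp: inj_on_def)
  also have "(\<Prod>i\<in>?O. emeasure \<mu> (?C i)) = (\<Prod>j\<in>J. emeasure \<mu> (B j))"
    by (subst prod.reindex) (auto simp: inj_on_def)
  finally show "emeasure (distr M pairs.law pair_sites) {c. \<forall>j\<in>J. fst (c j) \<in> A j \<and> snd (c j) \<in> B j}
      = (\<Prod>j\<in>J. emeasure \<mu> (A j)) * (\<Prod>j\<in>J. emeasure \<mu> (B j))" .
qed simp

lemma distr_unpair_sites: "distr pairs.law M unpair_sites = M"
proof -
  have "distr pairs.law M unpair_sites = distr (distr M pairs.law pair_sites) M unpair_sites"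
    by (simp only: distr_pair_sites)
  also have "\<dots> = distr M M (\<lambda>x. x)"
    by (subst distr_distr[OF unpair_sites_meas pair_sites_meas]) (simp add: comp_def)
  finally show ?thesis by simp
qed

lemma star1_meas: "Xstar1 F \<in> sets M"
  using star1 emeasure_notin_sets[of "Xstar1 F" M] by fastforce

lemma AE_star1: "AE x in M. x \<in> Xstar1 F"
  using star1 star1_meas by (subst M.P.AE_in_set_eq_1) (auto simp: M.P.emeasure_eq_measure)

definition shift :: "int \<Rightarrow> (int \<Rightarrow> 'x) \<Rightarrow> int \<Rightarrow> 'x" where
  "shift a x n = x (n + a)"

lemma shift_meas [measurable]: "shift a \<in> M \<rightarrow>\<^sub>M M"
  by (rule into_M_measI) (simp add: shift_def)

lemma distr_shift: "distr M M (shift a) = M"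
  using distr_PiM_reindex[of UNIV "\<lambda>_. \<mu>" "\<lambda>n. n + a" UNIV] prob_mu1
  by (simp add: shift_def[abs_def] restrict_UNIV)

lemma star2_iff: "c \<in> Xstar2 F \<longleftrightarrow> unpair_sites c \<in> Xstar1 F"
  by (metis pair_sites_star pair_unpair_sites)

lemma star2_eq: "Xstar2 F = unpair_sites -` Xstar1 F \<inter> space pairs.law"
  by (auto simp: star2_iff)

lemma star2_meas [measurable]: "Xstar2 F \<in> sets pairs.law"
  unfolding star2_eq by (rule measurable_sets[OF unpair_sites_meas star1_meas])

lemma T2_pairs_meas: "T2 F \<in> pairs.law \<rightarrow>\<^sub>M pairs.law"
proof -
  note [measurable] = T1_meas
  have "T2 F c = (if c \<in> Xstar2 F then pair_sites (shift 1 (T1 F (unpair_sites c))) else c)" for c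
    using pair_sites_dynamics(1)[of "unpair_sites c"]
    by (simp add: star2_iff shift_def[abs_def]) (simp add: T2_def star2_iff)
  then have eq: "T2 F = (\<lambda>c. if c \<in> Xstar2 F then pair_sites (shift 1 (T1 F (unpair_sites c))) else c)"
    by (rule ext)
  show ?thesis unfolding eq by measurable
qed

lemma U2_pairs_meas:
  "Uodd2 F n \<in> pairs.law \<rightarrow>\<^sub>M borel" "Ueven2 F n \<in> pairs.law \<rightarrow>\<^sub>M borel"
proof -
  note [measurable] = U1_meas
  \<comment> \<open>Off \<open>Xstar2 F\<close> the carrier is the projection of
    \<open>undefined\<close> in the sum type: a constant, which is all that measurability
    requires.\<close>
  have "Uodd2 F n c = (if c \<in> Xstar2 F then U1 F (2 * n - 1) (unpair_sites c) else projl (undefined :: 'u + 'u))" for c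
    using pair_sites_dynamics(2)[of "unpair_sites c" n]
    by (simp add: star2_iff) (simp add: Uodd2_def U2_def star2_iff)
  then have eq: "Uodd2 F n = (\<lambda>c. if c \<in> Xstar2 F then U1 F (2 * n - 1) (unpair_sites c) else projl (undefined :: 'u + 'u))"
    by (rule ext)
  show "Uodd2 F n \<in> pairs.law \<rightarrow>\<^sub>M borel" unfolding eq by measurable
  have "Ueven2 F n c = (if c \<in> Xstar2 F then U1 F (2 * n) (unpair_sites c) else projr (undefined :: 'u + 'u))" for c
    using pair_sites_dynamics(3)[of "unpair_sites c" n]
    by (simp add: star2_iff) (simp add: Ueven2_def U2_def star2_iff)
  then have eq: "Ueven2 F n = (\<lambda>c. if c \<in> Xstar2 F then U1 F (2 * n) (unpair_sites c) else projr (undefined :: 'u + 'u))"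
    by (rule ext)
  show "Ueven2 F n \<in> pairs.law \<rightarrow>\<^sub>M borel" unfolding eq by measurable
qed

sublocale t2: type2_model \<mu> \<mu> F
proof unfold_locales
  have "emeasure pairs.law (Xstar2 F) = emeasure (distr pairs.law M unpair_sites) (Xstar1 F)"
    unfolding star2_eq by (rule emeasure_distr[OF unpair_sites_meas star1_meas, symmetric])
  then show "emeasure pairs.law (Xstar2 F) = 1" by (simp only: distr_unpair_sites star1)
qed (fact F_borel bij sets_mu1 T2_pairs_meas U2_pairs_meas)+

text \<open>Almost surely \<open>T2 F\<close> is \<open>T1 F\<close> followed by a translation and
  seen through the pairing. Both changes are invertible and carry product laws to product laws, so
  they can be removed again.\<close>

lemma invariant_iff: "distr pairs.law pairs.law (T2 F) = pairs.law \<longleftrightarrow> distr M M (T1 F) = M"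
proof
  have "distr pairs.law pairs.law (T2 F) = distr (distr M pairs.law pair_sites) pairs.law (T2 F)"
    by (simp only: distr_pair_sites)
  also have "\<dots> = distr M pairs.law (T2 F \<circ> pair_sites)"
    by (rule distr_distr[OF T2_pairs_meas pair_sites_meas])
  also have "\<dots> = distr M pairs.law (pair_sites \<circ> (shift 1 \<circ> T1 F))"
  proof (rule distr_cong_AE[OF refl refl])
    show "AE x in M. (T2 F \<circ> pair_sites) x = (pair_sites \<circ> (shift 1 \<circ> T1 F)) x"
      using AE_star1 by eventually_elim (simp add: pair_sites_dynamics shift_def[abs_def])
  qed (rule measurable_comp[OF pair_sites_meas T2_pairs_meas]
      measurable_comp[OF measurable_comp[OF T1_meas shift_meas] pair_sites_meas])+
  also have "\<dots> = distr (distr (distr M M (T1 F)) M (shift 1)) pairs.law pair_sites"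
    by (simp only: distr_distr[OF shift_meas T1_meas]
      distr_distr[OF pair_sites_meas measurable_comp[OF T1_meas shift_meas]])
  finally have T2: "distr pairs.law pairs.law (T2 F)
      = distr (distr (distr M M (T1 F)) M (shift 1)) pairs.law pair_sites" .
  show "distr pairs.law pairs.law (T2 F) = pairs.law" if "distr M M (T1 F) = M"
    using T2 that by (simp only: distr_shift distr_pair_sites)
  assume inv: "distr pairs.law pairs.law (T2 F) = pairs.law"
  have "M = distr (distr pairs.law M unpair_sites) M (shift (- 1))"
    by (simp only: distr_unpair_sites distr_shift)
  also have "\<dots> = distr (distr (distr (distr (distr M M (T1 F)) M (shift 1)) pairs.law pair_sites) M unpair_sites) M (shift (- 1))"
    using T2 inv by simp
  also have "\<dots> = distr M M (shift (- 1) \<circ> (unpair_sites \<circ> (pair_sites \<circ> (shift 1 \<circ> T1 F))))"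
  proof -
    note m1 = measurable_comp[OF T1_meas shift_meas]
    note m2 = measurable_comp[OF m1 pair_sites_meas]
    note m3 = measurable_comp[OF m2 unpair_sites_meas]
    show ?thesis
      by (simp only: distr_distr[OF shift_meas T1_meas] distr_distr[OF pair_sites_meas m1]
          distr_distr[OF unpair_sites_meas m2] distr_distr[OF shift_meas m3])
  qed
  also have "shift (- 1) \<circ> (unpair_sites \<circ> (pair_sites \<circ> (shift 1 \<circ> T1 F))) = T1 F"
    by (simp add: fun_eq_iff shift_def)
  finally show "distr M M (T1 F) = M" by (rule sym)
qed

lemma distr_U1_pairs:
  assumes [measurable_cong]: "sets \<nu> = sets borel"
  shows "distr pairs.law \<nu> (Uodd2 F n) = distr M \<nu> (U1 F (2 * n - 1))"
    and "distr pairs.law \<nu> (Ueven2 F n) = distr M \<nu> (U1 F (2 * n))"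
proof -
  note [measurable] = U1_meas U2_pairs_meas
  have o: "Uodd2 F n \<in> pairs.law \<rightarrow>\<^sub>M \<nu>" and e: "Ueven2 F n \<in> pairs.law \<rightarrow>\<^sub>M \<nu>"
    and u: "U1 F m \<in> M \<rightarrow>\<^sub>M \<nu>" for m
    by measurable
  have "distr pairs.law \<nu> (Uodd2 F n) = distr M \<nu> (Uodd2 F n \<circ> pair_sites)"
    by (subst distr_distr[OF o pair_sites_meas, symmetric]) (simp only: distr_pair_sites)
  also have "\<dots> = distr M \<nu> (U1 F (2 * n - 1))"
  proof (rule distr_cong_AE[OF refl refl])
    show "AE x in M. (Uodd2 F n \<circ> pair_sites) x = U1 F (2 * n - 1) x"
      using AE_star1 by eventually_elim (simp add: pair_sites_dynamics)
  qed (rule measurable_comp[OF pair_sites_meas o] u)+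
  finally show "distr pairs.law \<nu> (Uodd2 F n) = distr M \<nu> (U1 F (2 * n - 1))" .
  have "distr pairs.law \<nu> (Ueven2 F n) = distr M \<nu> (Ueven2 F n \<circ> pair_sites)"
    by (subst distr_distr[OF e pair_sites_meas, symmetric]) (simp only: distr_pair_sites)
  also have "\<dots> = distr M \<nu> (U1 F (2 * n))"
  proof (rule distr_cong_AE[OF refl refl])
    show "AE x in M. (Ueven2 F n \<circ> pair_sites) x = U1 F (2 * n) x"
      using AE_star1 by eventually_elim (simp add: pair_sites_dynamics)
  qed (rule measurable_comp[OF pair_sites_meas e] u)+
  finally show "distr pairs.law \<nu> (Ueven2 F n) = distr M \<nu> (U1 F (2 * n))" .
qed

text \<open>The type II argument yields separate laws for carriers entering and leaving an even
  site; translation invariance identifies them in the type I model.\<close>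

lemma distr_U1_shift: "distr M borel (U1 F (n + 1)) = distr M borel (U1 F n)"
proof -
  have "AE x in M. shift 1 x \<in> Xstar1 F"
    by (rule AE_distrD[OF shift_meas]) (unfold distr_shift, rule AE_star1)
  with AE_star1 have "AE x in M. U1 F (n + 1) x = (U1 F n \<circ> shift 1) x"
    by eventually_elim (simp add: U1_shift shift_def[abs_def])
  then have "distr M borel (U1 F (n + 1)) = distr M borel (U1 F n \<circ> shift 1)"
    by (rule distr_cong_AE[OF refl refl _ U1_meas measurable_comp[OF shift_meas U1_meas]])
  also have "\<dots> = distr (distr M M (shift 1)) borel (U1 F n)"
    by (rule distr_distr[OF U1_meas shift_meas, symmetric])
  finally show ?thesis by (simp only: distr_shift)
qed

end

theorem theorem1p1:
  shows
  "(\<forall>(F :: 'x::polish_space \<times> 'u::polish_space \<Rightarrow> 'x \<times> 'u) (\<mu> :: 'x measure).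
      let M = (\<Pi>\<^sub>M n\<in>(UNIV :: int set). \<mu>) in
      F \<in> borel \<rightarrow>\<^sub>M borel \<and> (\<forall>z. F (F z) = z) \<and>
      prob_space \<mu> \<and> sets \<mu> = sets borel \<and>
      emeasure M (Xstar1 F) = 1 \<and>
      T1 F \<in> M \<rightarrow>\<^sub>M M \<and> (\<forall>n. U1 F n \<in> M \<rightarrow>\<^sub>M borel)
    \<longrightarrow>
      (distr M M (T1 F) = M \<longleftrightarrow>
         (\<exists>\<nu> :: 'u measure. prob_space \<nu> \<and> sets \<nu> = sets borel \<and>
            distr (\<mu> \<Otimes>\<^sub>M \<nu>) (\<mu> \<Otimes>\<^sub>M \<nu>) F = \<mu> \<Otimes>\<^sub>M \<nu>))
      \<and> (\<forall>\<nu> :: 'u measure. prob_space \<nu> \<and> sets \<nu> = sets borel \<and>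
            distr (\<mu> \<Otimes>\<^sub>M \<nu>) (\<mu> \<Otimes>\<^sub>M \<nu>) F = \<mu> \<Otimes>\<^sub>M \<nu>
          \<longrightarrow> (\<forall>n. distr M \<nu> (U1 F n) = \<nu>)))
   \<and>
   (\<forall>(F :: 'y::polish_space \<times> 'v::polish_space \<Rightarrow> 'yt::polish_space \<times> 'vt::polish_space)
      (\<mu> :: 'y measure) (\<mu>t :: 'yt measure).
      let M = (\<Pi>\<^sub>M n\<in>(UNIV :: int set). \<mu> \<Otimes>\<^sub>M \<mu>t) in
      F \<in> borel \<rightarrow>\<^sub>M borel \<and> bij F \<and>
      prob_space \<mu> \<and> sets \<mu> = sets borel \<and> prob_space \<mu>t \<and> sets \<mu>t = sets borel \<and>
      emeasure M (Xstar2 F) = 1 \<and>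
      T2 F \<in> M \<rightarrow>\<^sub>M M \<and> (\<forall>n. Uodd2 F n \<in> M \<rightarrow>\<^sub>M borel) \<and> (\<forall>n. Ueven2 F n \<in> M \<rightarrow>\<^sub>M borel)
    \<longrightarrow>
      (distr M M (T2 F) = M \<longleftrightarrow>
         (\<exists>(\<nu> :: 'v measure) (\<nu>t :: 'vt measure).
            prob_space \<nu> \<and> sets \<nu> = sets borel \<and> prob_space \<nu>t \<and> sets \<nu>t = sets borel \<and>
            distr (\<mu> \<Otimes>\<^sub>M \<nu>) (\<mu>t \<Otimes>\<^sub>M \<nu>t) F = \<mu>t \<Otimes>\<^sub>M \<nu>t))
      \<and> (\<forall>(\<nu> :: 'v measure) (\<nu>t :: 'vt measure).
            prob_space \<nu> \<and> sets \<nu> = sets borel \<and> prob_space \<nu>t \<and> sets \<nu>t = sets borel \<and>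
            distr (\<mu> \<Otimes>\<^sub>M \<nu>) (\<mu>t \<Otimes>\<^sub>M \<nu>t) F = \<mu>t \<Otimes>\<^sub>M \<nu>t
          \<longrightarrow> (\<forall>n. distr M \<nu> (Uodd2 F n) = \<nu> \<and> distr M \<nu>t (Ueven2 F n) = \<nu>t)))"
proof (intro conjI allI, goal_cases)
  case (1 F \<mu>)
  show ?case
    unfolding Let_def
  proof (intro impI, elim conjE)
    let ?M = "\<Pi>\<^sub>M n\<in>(UNIV :: int set). \<mu>"
    assume *: "F \<in> borel \<rightarrow>\<^sub>M borel" "\<forall>z. F (F z) = z" "prob_space \<mu>" "sets \<mu> = sets borel"
      "emeasure ?M (Xstar1 F) = 1" "T1 F \<in> ?M \<rightarrow>\<^sub>M ?M" "\<forall>n. U1 F n \<in> ?M \<rightarrow>\<^sub>M borel"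
    then have "F (F z) = z" for z by blast
    then interpret type1_model F \<mu>
      by (intro type1_model.intro involution.intro type1_model_axioms.intro) (use *(1,3-7) in simp_all)
    \<comment> \<open>The type II statement is used with the same \<open>\<nu>\<close> for both
      carrier spaces. Odd sites are written \<open>2 * (k + 1) - 1\<close> to match the indexing of
      \<open>Uodd2\<close>.\<close>
    have U: "distr ?M \<nu> (U1 F n) = \<nu>"
      if "prob_space \<nu>" "sets \<nu> = sets borel" "distr (\<mu> \<Otimes>\<^sub>M \<nu>) (\<mu> \<Otimes>\<^sub>M \<nu>) F = \<mu> \<Otimes>\<^sub>M \<nu>" for \<nu> n
    proof (cases "even n")
      case True
      then obtain k where "n = 2 * k" by (rule evenE)
      then show ?thesis
        using t2.distr_Ueven2[OF that(1,2,1,2,3), of k] distr_U1_pairs(2)[OF that(2), of k] by simp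
    next
      case False
      then obtain k where "n = 2 * (k + 1) - 1" by (auto elim!: oddE)
      then show ?thesis
        using t2.distr_Uodd2[OF that(1,2,1,2,3), of "k + 1"] distr_U1_pairs(1)[OF that(2), of "k + 1"]
        by (simp only:)
    qed
    have "\<exists>\<nu>. prob_space \<nu> \<and> sets \<nu> = sets borel \<and>
        distr (\<mu> \<Otimes>\<^sub>M \<nu>) (\<mu> \<Otimes>\<^sub>M \<nu>) F = \<mu> \<Otimes>\<^sub>M \<nu>" if "distr ?M ?M (T1 F) = ?M"
    proof (intro exI conjI)
      let ?\<nu> = "distr ?M borel (U1 F 0)"
      show "prob_space ?\<nu>" by (rule M.P.prob_space_distr[OF U1_meas])
      have "distr pairs.law pairs.law (T2 F) = pairs.law" using that invariant_iff by blast
      note t2.invariant_imp_detailed_balance[OF this]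
      \<comment> \<open>The type II balance involves the laws of the carriers at sites -1 and 0,
        equal here by translation.\<close>
      moreover have "distr pairs.law borel (Uodd2 F 0) = ?\<nu>"
        using distr_U1_pairs(1)[OF refl, of 0] distr_U1_shift[of "- 1"] by simp
      moreover have "distr pairs.law borel (Ueven2 F 0) = ?\<nu>"
        using distr_U1_pairs(2)[OF refl, of 0] by simp
      ultimately show "distr (\<mu> \<Otimes>\<^sub>M ?\<nu>) (\<mu> \<Otimes>\<^sub>M ?\<nu>) F = \<mu> \<Otimes>\<^sub>M ?\<nu>" by (simp only:)
    qed simp
    moreover have "distr ?M ?M (T1 F) = ?M"
      if "prob_space \<nu>" "sets \<nu> = sets borel" "distr (\<mu> \<Otimes>\<^sub>M \<nu>) (\<mu> \<Otimes>\<^sub>M \<nu>) F = \<mu> \<Otimes>\<^sub>M \<nu>" for \<nu>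
      using t2.balance_imp_invariant[OF that(1,2,1,2,3)] invariant_iff by blast
    ultimately show "(distr ?M ?M (T1 F) = ?M \<longleftrightarrow>
        (\<exists>\<nu>. prob_space \<nu> \<and> sets \<nu> = sets borel \<and> distr (\<mu> \<Otimes>\<^sub>M \<nu>) (\<mu> \<Otimes>\<^sub>M \<nu>) F = \<mu> \<Otimes>\<^sub>M \<nu>)) \<and>
      (\<forall>\<nu>. prob_space \<nu> \<and> sets \<nu> = sets borel \<and> distr (\<mu> \<Otimes>\<^sub>M \<nu>) (\<mu> \<Otimes>\<^sub>M \<nu>) F = \<mu> \<Otimes>\<^sub>M \<nu>
        \<longrightarrow> (\<forall>n. distr ?M \<nu> (U1 F n) = \<nu>))"
      using U by blast
  qed
next
  case (2 F \<mu> \<mu>t)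
  show ?case
    unfolding Let_def
  proof (intro impI, elim conjE)
    let ?M = "\<Pi>\<^sub>M n\<in>(UNIV :: int set). \<mu> \<Otimes>\<^sub>M \<mu>t"
    assume *: "F \<in> borel \<rightarrow>\<^sub>M borel" "bij F" "prob_space \<mu>" "sets \<mu> = sets borel"
      "prob_space \<mu>t" "sets \<mu>t = sets borel" "emeasure ?M (Xstar2 F) = 1" "T2 F \<in> ?M \<rightarrow>\<^sub>M ?M"
      "\<forall>n. Uodd2 F n \<in> ?M \<rightarrow>\<^sub>M borel" "\<forall>n. Ueven2 F n \<in> ?M \<rightarrow>\<^sub>M borel"
    have "space \<mu> = UNIV" "space \<mu>t = UNIV"
      using sets_eq_imp_space_eq[OF *(4)] sets_eq_imp_space_eq[OF *(6)] by simp_all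
    then interpret type2_model \<mu> \<mu>t F
      by (intro type2_model.intro product_law.intro type2_model_axioms.intro) (use * in simp_all)
    have "\<exists>\<nu> \<nu>t. prob_space \<nu> \<and> sets \<nu> = sets borel \<and> prob_space \<nu>t \<and> sets \<nu>t = sets borel \<and>
        distr (\<mu> \<Otimes>\<^sub>M \<nu>) (\<mu>t \<Otimes>\<^sub>M \<nu>t) F = \<mu>t \<Otimes>\<^sub>M \<nu>t" if "distr ?M ?M (T2 F) = ?M"
      using invariant_imp_detailed_balance[OF that]
        law.P.prob_space_distr[OF Uodd2_meas] law.P.prob_space_distr[OF Ueven2_meas]
      by (intro exI conjI) (assumption | simp)+
    then show "(distr ?M ?M (T2 F) = ?M \<longleftrightarrow>
        (\<exists>\<nu> \<nu>t. prob_space \<nu> \<and> sets \<nu> = sets borel \<and> prob_space \<nu>t \<and> sets \<nu>t = sets borel \<and>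
          distr (\<mu> \<Otimes>\<^sub>M \<nu>) (\<mu>t \<Otimes>\<^sub>M \<nu>t) F = \<mu>t \<Otimes>\<^sub>M \<nu>t)) \<and>
      (\<forall>\<nu> \<nu>t. prob_space \<nu> \<and> sets \<nu> = sets borel \<and> prob_space \<nu>t \<and> sets \<nu>t = sets borel \<and>
          distr (\<mu> \<Otimes>\<^sub>M \<nu>) (\<mu>t \<Otimes>\<^sub>M \<nu>t) F = \<mu>t \<Otimes>\<^sub>M \<nu>t
        \<longrightarrow> (\<forall>n. distr ?M \<nu> (Uodd2 F n) = \<nu> \<and> distr ?M \<nu>t (Ueven2 F n) = \<nu>t))"
      using balance_imp_invariant distr_Uodd2 distr_Ueven2 by blast
  qed
qed


end
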